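(* Let $0<\rho\le\frac13$, $\mathcal I_\rho=[-\rho,1+\rho]$, $n\ge1$ and $0\le k\le n$. The tensor product quasi-interpolation operator $$\Pi^{\otimes n}_k\colon(L^2\Lambda^{\otimes n})^k\to(\mathbb P\Lambda^{\otimes n})^k,\qquad \Pi^{\otimes n}_k=\sum_{\mathbf i\in\chi_k}\Pi_{i_1}\otimes\cdots\otimes\Pi_{i_n}$$ (defined in the context) is bounded in $L^2(\mathcal I_\rho^{\times n})$.
   Context: One-dimensional operators. On an interval, $0$-forms are functions and $1$-forms $v\,dx$ are identified with their coefficient $v$; $L^2\Lambda^0$ and $L^2\Lambda^1$ denote the spaces of $L^2$ $0$- and $1$-forms on $\mathcal I_\rho$. Let $\eta(x)=C\exp\bigl(\frac1{|x|^2-1}\bigr)$ for $|x|<1$, $\eta(x)=0$ for $|x|\ge1$, with $\int_{\mathbb R}\eta=1$; $\eta_l(x)=\frac1\rho\eta(\frac x\rho)$, $\eta_r(x)=\frac1\rho\eta(\frac{x-1}\rho)$; $B_l,B_r$ the intervals of radius $\rho$ centered at $0$ and $1$. For $y_l\in B_l$, $y_r\in B_r$ set $\widetilde{\mathcal N^0_1}(u)=u'(y_l)$, $\widetilde{\mathcal N^0_2}(u)=u'(y_r)$, $\widetilde{\mathcal N^0_3}(u)=u(y_r)-u(y_l)$, $\widetilde{\mathcal N^0_4}(u)=u(y_r)+u(y_l)$ for $u\in C^1(\mathcal I_\rho)$, and $\widetilde{\mathcal N^1_1}(v)=v(y_l)$, $\widetilde{\mathcal N^1_2}(v)=v(y_r)$,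 $\widetilde{\mathcal N^1_3}(v)=\int_{y_l}^{y_r}v\,dx$ for $v\in C^0(\mathcal I_\rho)$. Set $\overline{\mathcal N^k_i}(u)=\int_{B_l}\int_{B_r}\eta_l(\xi_l)\eta_r(\xi_r)\widetilde{\mathcal N^k_i}(u)\,d\xi_r\,d\xi_l$ with $y_l=\xi_l$, $y_r=\xi_r$; these functionals are $L^2(\mathcal I_\rho)$-bounded and are extended by continuity to $L^2(\mathcal I_\rho)$. Let $\varphi^0_1=x-2x^2+x^3$, $\varphi^0_2=-x^2+x^3$, $\varphi^0_3=-\frac12+3x^2-2x^3$, $\varphi^0_4=\frac12$; $\varphi^1_1=1-4x+3x^2$, $\varphi^1_2=-2x+3x^2$, $\varphi^1_3=6x-6x^2$. Define $\Pi_0u=\sum_{i=1}^4\overline{\mathcal N^0_i}(u)\varphi^0_i$ for $u\in L^2\Lambda^0$ and $\Pi_1v=\sum_{i=1}^3\overline{\mathcal N^1_i}(v)\varphi^1_i$ for $v\in L^2\Lambda^1$; moreover $\Pi_0$ is extended by $0$ to $1$-forms and $\Pi_1$ by $0$ to $0$-forms. Tensor products. $\chi_k=\{\boldsymbol\ell\in\{0,1\}^n:\sum_{j}\ell_j=k\}$. $(L^2\Lambda^{\otimes n})^k=\bigoplus_{\mathbf i\in\chi_k}L^2\Lambda^{i_1}\otimes\cdots\otimes L^2\Lambda^{i_n}$ (Hilbert space tensor products), which is a space of $k$-forms with coefficients in $L^2(\mathcal I_\rho^{\times n})$ and carries the corresponding norm. $(\mathbb P\Lambda^{\otimes n})^k=\bigoplus_{\mathbf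 i\in\chi_k}\mathbb P\Lambda^{i_1}\otimes\cdots\otimes\mathbb P\Lambda^{i_n}$ with $\mathbb P\Lambda^0=\mathbb P_3\Lambda^0$ ($0$-forms, polynomials of degree $\le3$) and $\mathbb P\Lambda^1=\mathbb P_2\Lambda^1$ ($1$-forms with polynomial coefficient of degree $\le2$); polynomials are regarded as functions on $\mathcal I_\rho^{\times n}$. Tensor products of bounded operators are defined by $(F\otimes G)(v\otimes w)=F(v)\otimes G(w)$ and extension by linearity and density. Thus for $u_j\in L^2\Lambda^{i_j}$, $\mathbf i\in\chi_k$: $\Pi^{\otimes n}_k(u_1\otimes\cdots\otimes u_n)=\Pi_{i_1}(u_1)\otimes\cdots\otimes\Pi_{i_n}(u_n)$. *)

theory Defs
  imports "HOL-Analysis.Analysis"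
begin

section \<open>Square-integrable functions\<close>

text \<open>
  Elements of an \<open>L\<^sup>2\<close> space are represented by square-integrable functions; equality of
  elements is equality almost everywhere.
\<close>

definition space_L2 :: "'a measure \<Rightarrow> ('a \<Rightarrow> real) set" where
  "space_L2 M = {f \<in> borel_measurable M. integrable M (\<lambda>x. (f x)\<^sup>2)}"

definition interval_I :: "real \<Rightarrow> real set" where
  "interval_I \<rho> = {-\<rho>..1 + \<rho>}"

abbreviation leb_I :: "real \<Rightarrow> real measure" where
  "leb_I \<rho> \<equiv> restrict_space lborel (interval_I \<rho>)"

abbreviation leb_cube :: "real \<Rightarrow> nat \<Rightarrow> (nat \<Rightarrow> real) measure" where
  "leb_cube \<rho> n \<equiv> Pi\<^sub>M {..<n} (\<lambda>_. leb_I \<rho>)"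


section \<open>The one-dimensional operators\<close>

definition bump :: "real \<Rightarrow> real" where
  "bump x = (if \<bar>x\<bar> < 1 then exp (1 / (\<bar>x\<bar>\<^sup>2 - 1)) else 0)"

definition eta :: "real \<Rightarrow> real" where
  "eta x = bump x / (LBINT t. bump t)"

definition eta_l :: "real \<Rightarrow> real \<Rightarrow> real" where
  "eta_l \<rho> x = (1 / \<rho>) * eta (x / \<rho>)"

definition eta_r :: "real \<Rightarrow> real \<Rightarrow> real" where
  "eta_r \<rho> x = (1 / \<rho>) * eta ((x - 1) / \<rho>)"

definition C0_on :: "real set \<Rightarrow> (real \<Rightarrow> real) set" where
  "C0_on S = {u. continuous_on S u}"

definition C1_on :: "real set \<Rightarrow> (real \<Rightarrow> real) set" where
  "C1_on S = {u. \<exists>u'. continuous_on S u' \<and>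
                   (\<forall>x\<in>S. (u has_real_derivative u' x) (at x within S))}"

text \<open>
  The points \<open>yl\<close>, \<open>yr\<close> range over the open balls of radius \<open>\<rho>\<close> around \<open>0\<close> and \<open>1\<close>, hence lie
  in the interior of the interval, where \<open>deriv u\<close> is the derivative of \<open>u \<in> C1_on (interval_I \<rho>)\<close>.
\<close>

definition Ntilde0 :: "nat \<Rightarrow> real \<Rightarrow> real \<Rightarrow> (real \<Rightarrow> real) \<Rightarrow> real" where
  "Ntilde0 i yl yr u =
     (if i = 1 then deriv u yl
      else if i = 2 then deriv u yr
      else if i = 3 then u yr - u yl
      else u yr + u yl)"

definition Ntilde1 :: "nat \<Rightarrow> real \<Rightarrow> real \<Rightarrow> (real \<Rightarrow> real) \<Rightarrow> real" where
  "Ntilde1 i yl yr v =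
     (if i = 1 then v yl
      else if i = 2 then v yr
      else (LBINT x=ereal yl..ereal yr. v x))"

definition average ::
    "real \<Rightarrow> (real \<Rightarrow> real \<Rightarrow> (real \<Rightarrow> real) \<Rightarrow> real) \<Rightarrow> (real \<Rightarrow> real) \<Rightarrow> real" where
  "average \<rho> N u =
     (LBINT yl:ball 0 \<rho>. (LBINT yr:ball 1 \<rho>. eta_l \<rho> yl * eta_r \<rho> yr * N yl yr u))"

text \<open>
  The value at \<open>u\<close> of the \<open>L\<^sup>2\<close>-continuous extension of a functional \<open>N\<close> given on the
  functions in \<open>D\<close>.
\<close>

definition extend_L2 ::
    "real \<Rightarrow> (real \<Rightarrow> real) set \<Rightarrow> ((real \<Rightarrow> real) \<Rightarrow> real) \<Rightarrow> (real \<Rightarrow> real) \<Rightarrow> real" where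
  "extend_L2 \<rho> D N u =
     (THE c. \<forall>s. (\<forall>m. s m \<in> D) \<and>
                 (\<lambda>m. \<integral>x. (s m x - u x)\<^sup>2 \<partial>leb_I \<rho>) \<longlonglongrightarrow> 0 \<longrightarrow>
                 (\<lambda>m. N (s m)) \<longlonglongrightarrow> c)"

definition Nbar0 :: "real \<Rightarrow> nat \<Rightarrow> (real \<Rightarrow> real) \<Rightarrow> real" where
  "Nbar0 \<rho> i = extend_L2 \<rho> (C1_on (interval_I \<rho>)) (average \<rho> (Ntilde0 i))"

definition Nbar1 :: "real \<Rightarrow> nat \<Rightarrow> (real \<Rightarrow> real) \<Rightarrow> real" where
  "Nbar1 \<rho> i = extend_L2 \<rho> (C0_on (interval_I \<rho>)) (average \<rho> (Ntilde1 i))"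

definition phi0 :: "nat \<Rightarrow> real \<Rightarrow> real" where
  "phi0 i x =
     (if i = 1 then x - 2 * x\<^sup>2 + x ^ 3
      else if i = 2 then - x\<^sup>2 + x ^ 3
      else if i = 3 then - (1 / 2) + 3 * x\<^sup>2 - 2 * x ^ 3
      else 1 / 2)"

definition phi1 :: "nat \<Rightarrow> real \<Rightarrow> real" where
  "phi1 i x =
     (if i = 1 then 1 - 4 * x + 3 * x\<^sup>2
      else if i = 2 then - 2 * x + 3 * x\<^sup>2
      else 6 * x - 6 * x\<^sup>2)"

text \<open>\<open>proj \<rho> 0\<close> and \<open>proj \<rho> 1\<close> are \<open>\<Pi>\<^sub>0\<close> and \<open>\<Pi>\<^sub>1\<close>, acting on coefficient functions.\<close>

definition proj :: "real \<Rightarrow> nat \<Rightarrow> (real \<Rightarrow> real) \<Rightarrow> real \<Rightarrow> real" where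
  "proj \<rho> d u x =
     (if d = 0 then (\<Sum>i=1..4. Nbar0 \<rho> i u * phi0 i x)
      else (\<Sum>i=1..3. Nbar1 \<rho> i u * phi1 i x))"

text \<open>
  A one-dimensional form of mixed degree is a family of coefficient functions indexed by the
  degree; only the degrees \<open>0\<close> and \<open>1\<close> are meaningful.
\<close>

type_synonym form1 = "nat \<Rightarrow> real \<Rightarrow> real"

definition pure_form :: "nat \<Rightarrow> (real \<Rightarrow> real) \<Rightarrow> form1" where
  "pure_form d u = (\<lambda>e. if e = d then u else (\<lambda>_. 0))"

definition L2_form1 :: "real \<Rightarrow> form1 set" where
  "L2_form1 \<rho> = {u. \<forall>d\<in>{0, 1}. u d \<in> space_L2 (leb_I \<rho>)}"

text \<open>\<open>\<Pi>\<^sub>d\<close> on forms of mixed degree: extended by \<open>0\<close> to the forms of the other degree.\<close>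

definition Proj :: "real \<Rightarrow> nat \<Rightarrow> form1 \<Rightarrow> form1" where
  "Proj \<rho> d u = pure_form d (proj \<rho> d (u d))"


section \<open>Tensor products\<close>

text \<open>
  A form on the cube is a family of coefficient functions indexed by the multi-indices
  \<open>i \<in> {0,1}\<^sup>n\<close>; its values at other indices are irrelevant.
\<close>

type_synonym formn = "(nat \<Rightarrow> nat) \<Rightarrow> (nat \<Rightarrow> real) \<Rightarrow> real"

definition multi :: "nat \<Rightarrow> (nat \<Rightarrow> nat) set" where
  "multi n = ({..<n} \<rightarrow>\<^sub>E {0, 1})"

definition chi :: "nat \<Rightarrow> nat \<Rightarrow> (nat \<Rightarrow> nat) set" where
  "chi n k = {l \<in> multi n. (\<Sum>j<n. l j) = k}"

definition L2_forms :: "real \<Rightarrow> nat \<Rightarrow> formn set" where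
  "L2_forms \<rho> n = {u. \<forall>i\<in>multi n. u i \<in> space_L2 (leb_cube \<rho> n)}"

definition norm_L2 :: "real \<Rightarrow> nat \<Rightarrow> formn \<Rightarrow> real" where
  "norm_L2 \<rho> n u = sqrt (\<Sum>i\<in>multi n. \<integral>x. (u i x)\<^sup>2 \<partial>leb_cube \<rho> n)"

definition eq_form :: "real \<Rightarrow> nat \<Rightarrow> formn \<Rightarrow> formn \<Rightarrow> bool" where
  "eq_form \<rho> n u v \<longleftrightarrow> (\<forall>i\<in>multi n. AE x in leb_cube \<rho> n. u i x = v i x)"

definition L2_kforms :: "real \<Rightarrow> nat \<Rightarrow> nat \<Rightarrow> formn set" where
  "L2_kforms \<rho> n k =
     {u \<in> L2_forms \<rho> n. \<forall>i\<in>multi n - chi n k. AE x in leb_cube \<rho> n. u i x = 0}"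

text \<open>
  The space of polynomial \<open>k\<close>-forms: in component \<open>i\<close>, finite sums of products of one-variable
  polynomials of degree at most \<open>3\<close> in the variables with \<open>i j = 0\<close> and at most \<open>2\<close> in those
  with \<open>i j = 1\<close>.
\<close>

definition poly_kforms :: "real \<Rightarrow> nat \<Rightarrow> nat \<Rightarrow> formn set" where
  "poly_kforms \<rho> n k =
     {w \<in> L2_kforms \<rho> n k. \<forall>i\<in>chi n k. \<exists>ps :: (nat \<Rightarrow> real poly) list.
        (\<forall>p\<in>set ps. \<forall>j<n. degree (p j) \<le> (if i j = 0 then 3 else 2)) \<and>
        (AE x in leb_cube \<rho> n. w i x = (\<Sum>p\<leftarrow>ps. \<Prod>j<n. poly (p j) (x j)))}"

definition tensor :: "nat \<Rightarrow> (nat \<Rightarrow> form1) \<Rightarrow> formn" where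
  "tensor n u = (\<lambda>i x. \<Prod>j<n. u j (i j) (x j))"

text \<open>
  The tensor product \<open>F 0 \<otimes> \<cdots> \<otimes> F (n - 1)\<close>, defined on elementary tensors by
  \<open>tensor n v \<mapsto> tensor n (\<lambda>j. F j (v j))\<close>, then on finite sums of these (given as lists) by
  linearity, and on all \<open>L\<^sup>2\<close> forms by density: \<open>w\<close> is the value at \<open>u\<close> if the images of any
  finite sums of elementary tensors converging to \<open>u\<close> in \<open>L\<^sup>2\<close> converge to \<open>w\<close> in \<open>L\<^sup>2\<close>.
  Such a \<open>w\<close> is determined only up to equality almost everywhere, hence the use of \<open>SOME\<close>.
\<close>

definition is_tensor_op_value ::
    "real \<Rightarrow> nat \<Rightarrow> (nat \<Rightarrow> form1 \<Rightarrow> form1) \<Rightarrow> formn \<Rightarrow> formn \<Rightarrow> bool" where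
  "is_tensor_op_value \<rho> n F u w \<longleftrightarrow> w \<in> L2_forms \<rho> n \<and>
     (\<forall>s :: nat \<Rightarrow> (nat \<Rightarrow> form1) list.
        (\<forall>m. \<forall>v\<in>set (s m). \<forall>j<n. v j \<in> L2_form1 \<rho>) \<and>
        (\<lambda>m. norm_L2 \<rho> n (\<lambda>i x. (\<Sum>v\<leftarrow>s m. tensor n v i x) - u i x)) \<longlonglongrightarrow> 0 \<longrightarrow>
        (\<lambda>m. norm_L2 \<rho> n
               (\<lambda>i x. (\<Sum>v\<leftarrow>s m. tensor n (\<lambda>j. F j (v j)) i x) - w i x)) \<longlonglongrightarrow> 0)"

definition tensor_op :: "real \<Rightarrow> nat \<Rightarrow> (nat \<Rightarrow> form1 \<Rightarrow> form1) \<Rightarrow> formn \<Rightarrow> formn" where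
  "tensor_op \<rho> n F u = (SOME w. is_tensor_op_value \<rho> n F u w)"

definition quasi_interp :: "real \<Rightarrow> nat \<Rightarrow> nat \<Rightarrow> formn \<Rightarrow> formn" where
  "quasi_interp \<rho> n k u =
     (\<lambda>l x. \<Sum>i\<in>chi n k. tensor_op \<rho> n (\<lambda>j. Proj \<rho> (i j)) u l x)"

text \<open>Bounded linear operators between spaces of \<open>L\<^sup>2\<close> forms, modulo equality almost everywhere.\<close>

definition bounded_L2_operator ::
    "real \<Rightarrow> nat \<Rightarrow> formn set \<Rightarrow> formn set \<Rightarrow> (formn \<Rightarrow> formn) \<Rightarrow> bool" where
  "bounded_L2_operator \<rho> n X Y T \<longleftrightarrow>
     (\<forall>u\<in>X. T u \<in> Y) \<and>
     (\<forall>u\<in>X. \<forall>v\<in>X. eq_form \<rho> n u v \<longrightarrow> eq_form \<rho> n (T u) (T v)) \<and>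
     (\<forall>u\<in>X. \<forall>v\<in>X. \<forall>a b :: real.
        eq_form \<rho> n (T (\<lambda>i x. a * u i x + b * v i x)) (\<lambda>i x. a * T u i x + b * T v i x)) \<and>
     (\<exists>C::real. \<forall>u\<in>X. norm_L2 \<rho> n (T u) \<le> C * norm_L2 \<rho> n u)"

end

theory Submission
  imports Defs
begin

text \<open>
  Each averaged functional is integration against a square-integrable kernel: the averages of
  \<open>u'\<close> and of the integral of \<open>v\<close> are integrated by parts, which moves the derivative onto, or the
  integral over to, the smooth weight. Since \<open>C\<^sup>1\<close> functions are dense in \<open>L\<^sup>2\<close>, the continuous
  extension is given by the same kernel. Each \<open>\<Pi>\<^sub>d\<close> is therefore of finite rank, and expanding
  products of sums writes the tensor product operator in component \<open>i\<close> as
  \<open>u \<mapsto> \<Sum>\<^sub>a \<langle>\<Otimes>\<^sub>j g (i j) (a j), u\<rangle> \<Otimes>\<^sub>j \<phi> (i j) (a j)\<close>, whose \<open>L\<^sup>2\<close> bound is Cauchy--Schwarz.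
  The density of sums of elementary tensors makes this the only possible value of the extension.
\<close>

section \<open>Approximation in \<open>L\<^sup>2\<close>\<close>

text \<open>Both extensions are defined by a condition on all approximating sequences, under
  \<open>THE\<close> for the functionals and under \<open>SOME\<close> for the tensor operator. Such
  a condition has two sides: the candidate must be the limit along every sequence, which is
  continuity, and at least one sequence must exist, since otherwise every value would satisfy the
  condition vacuously. The second side is why density is proved, for \<open>C1_on\<close> on the
  interval and for sums of products on the cube. Both cases share the argument in
  \<open>L2_subspace\<close>: only indicators of an intersection-stable generator have to be
  approximated. The obstacle in the integration by parts is the edge of the ball supporting the
  weight. There only continuity is established, together with a bounded derivative elsewhere; a
  fundamental theorem of calculus with finitely many exceptional points does the rest. Finite rank
  keeps the tensor product elementary: the coefficients are integrals against product kernels, which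
  make sense for every L2 function on the cube, so the extended operator can be written down without
  passing to a limit.\<close>

lemma LIMSEQ_squeeze_0:
  fixes f h :: "nat \<Rightarrow> real"
  assumes "h \<longlonglongrightarrow> 0" "\<And>m. 0 \<le> f m" "\<And>m. f m \<le> h m"
  shows "f \<longlonglongrightarrow> 0"
  by (rule tendsto_sandwich[OF always_eventually always_eventually tendsto_const assms(1)])
    (use assms in auto)

section \<open>Vector space structure, Cauchy-Schwarz inequality and uniqueness of limits in
  L2\<close>

lemma space_L2_mult_integrable:
  assumes "f \<in> space_L2 M" "g \<in> space_L2 M"
  shows "integrable M (\<lambda>x. f x * g x)"
proof (rule Bochner_Integration.integrable_bound)
  show "integrable M (\<lambda>x. (f x)\<^sup>2 + (g x)\<^sup>2)"
    using assms by (auto simp: space_L2_def)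
  show "(\<lambda>x. f x * g x) \<in> borel_measurable M"
    using assms by (auto simp: space_L2_def)
  have "\<bar>a * b\<bar> \<le> a\<^sup>2 + b\<^sup>2" for a b :: real
  proof -
    have "2 * \<bar>a * b\<bar> \<le> a\<^sup>2 + b\<^sup>2"
      using sum_squares_bound[of "\<bar>a\<bar>" "\<bar>b\<bar>"] by (simp add: abs_mult)
    moreover have "0 \<le> \<bar>a * b\<bar>" by simp
    ultimately show ?thesis by linarith
  qed
  then show "AE x in M. norm (f x * g x) \<le> norm ((f x)\<^sup>2 + (g x)\<^sup>2)"
    by (intro AE_I2) simp
qed

lemma space_L2_measurable [measurable_dest]: "f \<in> space_L2 M \<Longrightarrow> f \<in> borel_measurable M"
  by (simp add: space_L2_def)

lemma space_L2_integrable: "f \<in> space_L2 M \<Longrightarrow> integrable M (\<lambda>x. (f x)\<^sup>2)"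
  by (simp add: space_L2_def)

lemma space_L2_zero: "(\<lambda>_. 0) \<in> space_L2 M"
  by (simp add: space_L2_def)

lemma space_L2_scale:
  assumes "f \<in> space_L2 M" shows "(\<lambda>x. c * f x) \<in> space_L2 M"
  using assms by (auto simp: space_L2_def power_mult_distrib)

lemma space_L2_add:
  assumes "f \<in> space_L2 M" "g \<in> space_L2 M"
  shows "(\<lambda>x. f x + g x) \<in> space_L2 M"
proof -
  have "integrable M (\<lambda>x. (f x)\<^sup>2 + (g x)\<^sup>2 + 2 * (f x * g x))"
    using assms by (intro Bochner_Integration.integrable_add integrable_mult_right
        space_L2_mult_integrable space_L2_integrable)
  moreover have "(\<lambda>x. (f x)\<^sup>2 + (g x)\<^sup>2 + 2 * (f x * g x)) = (\<lambda>x. (f x + g x)\<^sup>2)"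
    by (auto simp: power2_sum)
  ultimately show ?thesis using assms by (auto simp: space_L2_def)
qed

lemma space_L2_diff:
  assumes "f \<in> space_L2 M" "g \<in> space_L2 M"
  shows "(\<lambda>x. f x - g x) \<in> space_L2 M"
  using space_L2_add[OF assms(1) space_L2_scale[OF assms(2), of "-1"]] by simp

lemma space_L2_sum:
  assumes "\<And>i. i \<in> I \<Longrightarrow> f i \<in> space_L2 M"
  shows "(\<lambda>x. \<Sum>i\<in>I. f i x) \<in> space_L2 M"
  using assms
  by (induction I rule: infinite_finite_induct) (auto intro: space_L2_zero space_L2_add)

lemma space_L2_sum_list:
  assumes "\<And>v. v \<in> set vs \<Longrightarrow> f v \<in> space_L2 M"
  shows "(\<lambda>x. \<Sum>v\<leftarrow>vs. f v x) \<in> space_L2 M"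
  using assms by (induction vs) (auto intro: space_L2_zero space_L2_add)

lemma space_L2_bounded:
  assumes "finite_measure M" "f \<in> borel_measurable M" "\<And>x. x \<in> space M \<Longrightarrow> \<bar>f x\<bar> \<le> B"
  shows "f \<in> space_L2 M"
proof -
  interpret finite_measure M by fact
  have "norm ((f x)\<^sup>2) \<le> B\<^sup>2" if "x \<in> space M" for x
    using power_mono[OF assms(3)[OF that], of 2] by simp
  then show ?thesis
    using assms(2) unfolding space_L2_def
    by (auto intro!: integrable_const_bound[of _ "B\<^sup>2"])
qed

lemma space_L2_imp_integrable:
  assumes "finite_measure M" "f \<in> space_L2 M"
  shows "integrable M f"
  using finite_measure.square_integrable_imp_integrable[OF assms(1)] assms(2)
  by (auto simp: space_L2_def)

text \<open>The quadratic \<open>A - 2 * t * C + t\<^sup>2 * B\<close> is the integral of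
  \<open>(f x - t * g x)\<^sup>2\<close>, hence nonnegative for every \<open>t\<close>; evaluating
  it at one suitable \<open>t\<close> gives the inequality.\<close>

lemma L2_Cauchy_Schwarz:
  assumes "f \<in> space_L2 M" "g \<in> space_L2 M"
  shows "(\<integral>x. f x * g x \<partial>M)\<^sup>2 \<le> (\<integral>x. (f x)\<^sup>2 \<partial>M) * (\<integral>x. (g x)\<^sup>2 \<partial>M)"
proof -
  define A B C where "A = (\<integral>x. (f x)\<^sup>2 \<partial>M)" and "B = (\<integral>x. (g x)\<^sup>2 \<partial>M)"
    and "C = (\<integral>x. f x * g x \<partial>M)"
  note [simp] = space_L2_integrable[OF assms(1)] space_L2_integrable[OF assms(2)]
    space_L2_mult_integrable[OF assms]
  have nonneg: "0 \<le> A - 2 * t * C + t\<^sup>2 * B" for t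
  proof -
    have "A - 2 * t * C + t\<^sup>2 * B = (\<integral>x. (f x)\<^sup>2 - 2 * t * (f x * g x) + t\<^sup>2 * (g x)\<^sup>2 \<partial>M)"
      by (simp add: A_def B_def C_def)
    also have "\<dots> = (\<integral>x. (f x - t * g x)\<^sup>2 \<partial>M)"
      by (intro Bochner_Integration.integral_cong) (auto simp: power2_eq_square algebra_simps)
    also have "\<dots> \<ge> 0" by simp
    finally show ?thesis .
  qed
  have "0 \<le> A" "0 \<le> B" by (simp_all add: A_def B_def)
  have "C\<^sup>2 \<le> A * B"
  proof (cases "B = 0")
    case True
    have "C = 0"
    proof (rule ccontr)
      assume "C \<noteq> 0"
      \<comment> \<open>With \<open>B = 0\<close> the quadratic is affine in \<open>t\<close>, and
        this \<open>t\<close> gives it the value -1.\<close>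
      then show False using nonneg[of "(A + 1) / (2 * C)"] True by simp
    qed
    then show ?thesis using True by simp
  next
    case False
    then have "B > 0" using \<open>0 \<le> B\<close> by simp
    \<comment> \<open>\<open>C / B\<close> is the minimiser of the quadratic.\<close>
    have "0 \<le> B * (A - 2 * (C / B) * C + (C / B)\<^sup>2 * B)"
      using nonneg[of "C / B"] \<open>B > 0\<close> by (intro mult_nonneg_nonneg) auto
    also have "\<dots> = A * B - C\<^sup>2"
      using False by (simp add: field_simps power2_eq_square)
    finally show ?thesis by simp
  qed
  then show ?thesis by (simp add: A_def B_def C_def)
qed

lemma L2_dist_triangle:
  assumes "f \<in> space_L2 M" "g \<in> space_L2 M" "h \<in> space_L2 M"
  shows "(\<integral>x. (f x - h x)\<^sup>2 \<partial>M) \<le> 2 * (\<integral>x. (f x - g x)\<^sup>2 \<partial>M) + 2 * (\<integral>x. (g x - h x)\<^sup>2 \<partial>M)"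
proof -
  note fg = space_L2_integrable[OF space_L2_diff[OF assms(1,2)]]
  note gh = space_L2_integrable[OF space_L2_diff[OF assms(2,3)]]
  note fh = space_L2_integrable[OF space_L2_diff[OF assms(1,3)]]
  have "(\<integral>x. (f x - h x)\<^sup>2 \<partial>M) \<le> (\<integral>x. 2 * (f x - g x)\<^sup>2 + 2 * (g x - h x)\<^sup>2 \<partial>M)"
  proof (rule integral_mono)
    show "(f x - h x)\<^sup>2 \<le> 2 * (f x - g x)\<^sup>2 + 2 * (g x - h x)\<^sup>2" for x
      \<comment> \<open>The right side minus the left side is exactly this square.\<close>
      using zero_le_power2[of "(f x - g x) - (g x - h x)"]
      by (simp add: power2_eq_square algebra_simps)
  qed (use fg gh fh in auto)
  also have "\<dots> = 2 * (\<integral>x. (f x - g x)\<^sup>2 \<partial>M) + 2 * (\<integral>x. (g x - h x)\<^sup>2 \<partial>M)"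
    using fg gh by simp
  finally show ?thesis .
qed

lemma L2_limit_unique:
  assumes s: "\<And>m. s m \<in> space_L2 M" and f: "f \<in> space_L2 M" and g: "g \<in> space_L2 M"
    and sf: "(\<lambda>m. \<integral>x. (s m x - f x)\<^sup>2 \<partial>M) \<longlonglongrightarrow> 0"
    and sg: "(\<lambda>m. \<integral>x. (s m x - g x)\<^sup>2 \<partial>M) \<longlonglongrightarrow> 0"
  shows "AE x in M. f x = g x"
proof -
  let ?I = "\<integral>x. (f x - g x)\<^sup>2 \<partial>M"
  have "?I \<le> 0"
  proof (rule LIMSEQ_le)
    show "(\<lambda>m. ?I) \<longlonglongrightarrow> ?I" by simp
    show "(\<lambda>m. 2 * (\<integral>x. (s m x - f x)\<^sup>2 \<partial>M) + 2 * (\<integral>x. (s m x - g x)\<^sup>2 \<partial>M)) \<longlonglongrightarrow> 0"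
      using tendsto_add[OF tendsto_mult_left[OF sf, of 2] tendsto_mult_left[OF sg, of 2]] by simp
    show "\<exists>N. \<forall>n\<ge>N. ?I \<le> 2 * (\<integral>x. (s n x - f x)\<^sup>2 \<partial>M) + 2 * (\<integral>x. (s n x - g x)\<^sup>2 \<partial>M)"
      using L2_dist_triangle[OF f s g] by (simp add: power2_commute)
  qed
  moreover have "0 \<le> ?I" by simp
  ultimately have "?I = 0" by linarith
  then have "AE x in M. (f x - g x)\<^sup>2 = 0"
    using integral_nonneg_eq_0_iff_AE[OF space_L2_integrable[OF space_L2_diff[OF f g]]] by simp
  then show ?thesis by simp
qed

section \<open>Closure in L2, and density reduced to a generator of the sigma-algebra\<close>

text \<open>For \<open>f\<close> in L2 and \<open>V\<close> inside L2 this is membership in the L2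
  closure of \<open>V\<close>. Distances stay squared, so the triangle inequality costs a factor 2
  and closure arguments start from \<open>e / 4\<close>.\<close>

definition L2_approximable :: "'a measure \<Rightarrow> ('a \<Rightarrow> real) set \<Rightarrow> ('a \<Rightarrow> real) \<Rightarrow> bool" where
  "L2_approximable M V f \<longleftrightarrow> (\<forall>e>0. \<exists>v\<in>V. (\<integral>x. (v x - f x)\<^sup>2 \<partial>M) < e)"

lemma L2_approximable_sequence:
  assumes "L2_approximable M V f"
  obtains s where "\<And>m. s m \<in> V" "(\<lambda>m. \<integral>x. (s m x - f x)\<^sup>2 \<partial>M) \<longlonglongrightarrow> 0"
proof -
  have "\<exists>v\<in>V. (\<integral>x. (v x - f x)\<^sup>2 \<partial>M) < 1 / real (Suc m)" for m
    using assms by (auto simp: L2_approximable_def)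
  then obtain s where s: "\<And>m. s m \<in> V" "\<And>m. (\<integral>x. (s m x - f x)\<^sup>2 \<partial>M) < 1 / real (Suc m)"
    by metis
  have "(\<lambda>m. \<integral>x. (s m x - f x)\<^sup>2 \<partial>M) \<longlonglongrightarrow> 0"
  proof (rule LIMSEQ_squeeze_0)
    show "(\<lambda>m. 1 / real (Suc m)) \<longlonglongrightarrow> 0"
      using LIMSEQ_inverse_real_of_nat by (simp add: inverse_eq_divide)
    show "(\<integral>x. (s m x - f x)\<^sup>2 \<partial>M) \<le> 1 / real (Suc m)" for m
      using s(2)[of m] by simp
  qed simp
  with s(1) that show ?thesis by blast
qed

lemma L2_approximable_member:
  assumes "v \<in> V" "\<And>x. x \<in> space M \<Longrightarrow> v x = f x"
  shows "L2_approximable M V f"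
proof -
  have "(\<integral>x. (v x - f x)\<^sup>2 \<partial>M) = (\<integral>x. 0 \<partial>M)"
    by (intro Bochner_Integration.integral_cong) (auto simp: assms)
  then show ?thesis using assms(1) by (auto simp: L2_approximable_def intro!: bexI[of _ v])
qed

lemma L2_approximable_limit:
  assumes V: "V \<subseteq> space_L2 M" and s: "\<And>m. s m \<in> space_L2 M" "\<And>m::nat. L2_approximable M V (s m)"
    and f: "f \<in> space_L2 M" and lim: "(\<lambda>m. \<integral>x. (s m x - f x)\<^sup>2 \<partial>M) \<longlonglongrightarrow> 0"
  shows "L2_approximable M V f"
  unfolding L2_approximable_def
proof (intro allI impI)
  fix e :: real assume "e > 0"
  then obtain m where m: "(\<integral>x. (s m x - f x)\<^sup>2 \<partial>M) < e / 4"
    using LIMSEQ_D[OF lim, of "e / 4"] by fastforce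
  obtain v where v: "v \<in> V" "(\<integral>x. (v x - s m x)\<^sup>2 \<partial>M) < e / 4"
    using s(2)[of m] \<open>e > 0\<close> unfolding L2_approximable_def by (meson divide_pos_pos zero_less_numeral)
  have "(\<integral>x. (v x - f x)\<^sup>2 \<partial>M) < e"
    using L2_dist_triangle[of v M "s m" f] V v s(1)[of m] f m by fastforce
  with v show "\<exists>v\<in>V. (\<integral>x. (v x - f x)\<^sup>2 \<partial>M) < e" by blast
qed

text \<open>The form in which closedness is applied below: dominated convergence turns pointwise
  convergence almost everywhere into L2 convergence.\<close>

lemma L2_approximable_limit_dominated:
  assumes V: "V \<subseteq> space_L2 M" and s: "\<And>m. s m \<in> space_L2 M" "\<And>m::nat. L2_approximable M V (s m)"
    and f: "f \<in> space_L2 M" and w: "integrable M w"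
    and lim: "AE x in M. (\<lambda>m. s m x) \<longlonglongrightarrow> f x"
    and bound: "\<And>m x. x \<in> space M \<Longrightarrow> (s m x - f x)\<^sup>2 \<le> w x"
  shows "L2_approximable M V f"
proof (rule L2_approximable_limit[OF V s f])
  have [measurable]: "\<And>m. s m \<in> borel_measurable M" "f \<in> borel_measurable M"
    using s(1) f by (auto dest: space_L2_measurable)
  have "(\<lambda>m. \<integral>x. (s m x - f x)\<^sup>2 \<partial>M) \<longlonglongrightarrow> (\<integral>x. 0 \<partial>M)"
  proof (rule integral_dominated_convergence[where w = w])
    show "AE x in M. (\<lambda>m. (s m x - f x)\<^sup>2) \<longlonglongrightarrow> 0"
      using lim
    proof eventually_elim
      case (elim x)
      have "(\<lambda>m. (s m x - f x)\<^sup>2) \<longlonglongrightarrow> (f x - f x)\<^sup>2"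
        by (intro tendsto_intros elim)
      then show ?case by simp
    qed
    show "AE x in M. norm ((s m x - f x)\<^sup>2) \<le> w x" for m
      using bound by (intro AE_I2) simp
  qed (use w in auto)
  then show "(\<lambda>m. \<integral>x. (s m x - f x)\<^sup>2 \<partial>M) \<longlonglongrightarrow> 0" by simp
qed

text \<open>Shared setting for the two density results. \<open>one_mem\<close> serves the complement
  step of Dynkin's argument, where the new indicator is 1 minus the old one; finiteness of the
  measure puts indicators into L2.\<close>

locale L2_subspace = finite_measure M for M :: "'a measure" +
  fixes V :: "('a \<Rightarrow> real) set"
  assumes subset_L2: "V \<subseteq> space_L2 M"
    and add_closed: "u \<in> V \<Longrightarrow> v \<in> V \<Longrightarrow> (\<lambda>x. u x + v x) \<in> V"
    and scale_closed: "u \<in> V \<Longrightarrow> (\<lambda>x. c * u x) \<in> V"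
    and one_mem: "(\<lambda>_. 1) \<in> V"
begin

lemma approximable_scale:
  assumes "L2_approximable M V f"
  shows "L2_approximable M V (\<lambda>x. c * f x)"
  unfolding L2_approximable_def
proof (intro allI impI)
  fix e :: real assume e: "e > 0"
  \<comment> \<open>Dividing by \<open>c\<^sup>2 + 1\<close> rather than \<open>c\<^sup>2\<close>
    covers \<open>c = 0\<close>.\<close>
  have p: "c\<^sup>2 + 1 > 0" by (simp add: add_nonneg_pos)
  obtain v where v: "v \<in> V" "(\<integral>x. (v x - f x)\<^sup>2 \<partial>M) < e / (c\<^sup>2 + 1)"
    using assms divide_pos_pos[OF e p] unfolding L2_approximable_def by blast
  have "(\<integral>x. (c * v x - c * f x)\<^sup>2 \<partial>M) = c\<^sup>2 * (\<integral>x. (v x - f x)\<^sup>2 \<partial>M)"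
    by (simp add: right_diff_distrib[symmetric] power_mult_distrib)
  also have "\<dots> \<le> (c\<^sup>2 + 1) * (\<integral>x. (v x - f x)\<^sup>2 \<partial>M)"
    by (intro mult_right_mono) auto
  also have "\<dots> < e" using v(2) p by (simp add: field_simps)
  finally show "\<exists>v\<in>V. (\<integral>x. (v x - c * f x)\<^sup>2 \<partial>M) < e"
    by (intro bexI[OF _ scale_closed[OF v(1)]])
qed

lemma approximable_add:
  assumes "L2_approximable M V f" "L2_approximable M V g" "f \<in> space_L2 M" "g \<in> space_L2 M"
  shows "L2_approximable M V (\<lambda>x. f x + g x)"
  unfolding L2_approximable_def
proof (intro allI impI)
  fix e :: real assume "e > 0"
  then obtain u v where uv: "u \<in> V" "(\<integral>x. (u x - f x)\<^sup>2 \<partial>M) < e / 4"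
    "v \<in> V" "(\<integral>x. (v x - g x)\<^sup>2 \<partial>M) < e / 4"
    using assms unfolding L2_approximable_def by (meson divide_pos_pos zero_less_numeral)
  have L2: "(\<lambda>x. u x + v x) \<in> space_L2 M" "(\<lambda>x. f x + v x) \<in> space_L2 M" "(\<lambda>x. f x + g x) \<in> space_L2 M"
    using uv assms subset_L2 by (auto intro!: space_L2_add)
  have "(\<integral>x. ((u x + v x) - (f x + g x))\<^sup>2 \<partial>M) < e"
    using L2_dist_triangle[OF L2] uv by simp
  then show "\<exists>v\<in>V. (\<integral>x. (v x - (f x + g x))\<^sup>2 \<partial>M) < e"
    by (intro bexI[OF _ add_closed[OF uv(1,3)]])
qed

lemma approximable_sum:
  assumes "finite I" "\<And>i. i \<in> I \<Longrightarrow> L2_approximable M V (f i)" "\<And>i. i \<in> I \<Longrightarrow> f i \<in> space_L2 M"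
  shows "L2_approximable M V (\<lambda>x. \<Sum>i\<in>I. f i x)"
  using assms
proof (induction I)
  case empty
  then show ?case using L2_approximable_member[OF scale_closed[OF one_mem, of 0]] by simp
next
  case (insert i I)
  then show ?case by (simp add: approximable_add space_L2_sum)
qed

lemma indicator_space_L2: "A \<in> sets M \<Longrightarrow> indicator A \<in> space_L2 M"
  by (rule space_L2_bounded[where B = 1]) (auto simp: indicator_def finite_measure_axioms)

text \<open>The sets with approximable indicator form a Dynkin system: complements come from
  linearity and the constant 1, disjoint unions from dominated convergence of the partial
  sums.\<close>

lemma approximable_indicator:
  assumes G: "Int_stable G" "G \<subseteq> Pow (space M)" "sets M = sigma_sets (space M) G"
    and gen: "\<And>A. A \<in> G \<Longrightarrow> L2_approximable M V (indicator A)"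
    and A: "A \<in> sets M"
  shows "L2_approximable M V (indicator A)"
  using G(1,2) A[unfolded G(3)]
proof (induction rule: sigma_sets_induct_disjoint)
  case (basic A)
  then show ?case by (rule gen)
next
  case empty
  show ?case using L2_approximable_member[OF scale_closed[OF one_mem, of 0]] by simp
next
  case (compl A)
  have A: "A \<in> sets M" using compl G(3) by simp
  have "L2_approximable M V (\<lambda>x. 1 + (- 1) * indicator A x)"
    using compl(2) indicator_space_L2[OF A] subset_L2 one_mem
    by (intro approximable_add approximable_scale space_L2_scale
        L2_approximable_member[of "\<lambda>_. 1" V M "\<lambda>_. 1"]) auto
  moreover have "(\<integral>x. (v x - (1 + (- 1) * indicator A x))\<^sup>2 \<partial>M)
      = (\<integral>x. (v x - indicator (space M - A) x)\<^sup>2 \<partial>M)" for v :: "'a \<Rightarrow> real"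
    by (intro Bochner_Integration.integral_cong) (auto simp: indicator_def)
  ultimately show ?case by (simp add: L2_approximable_def)
next
  case (union A)
  have A: "A i \<in> sets M" for i using union(2) G(3) by auto
  have UA: "(\<Union>i. A i) \<in> sets M" using A by auto
  define s where "s m x = (\<Sum>i<m. indicator (A i) x :: real)" for m x
  \<comment> \<open>By disjointness the partial sums are again indicators, so the squared error is
    at most 1, an integrable bound.\<close>
  have s: "s m = indicator (\<Union>i<m. A i)" for m
    unfolding s_def using union(1)
    by (auto simp: fun_eq_iff indicator_UN_disjoint disjoint_family_on_def)
  show ?case
  proof (rule L2_approximable_limit_dominated[where s = s and w = "\<lambda>_. 1"])
    show "s m \<in> space_L2 M" for m
      unfolding s using A by (intro indicator_space_L2) auto
    show "L2_approximable M V (s m)" for m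
      unfolding s_def using union(3) A by (intro approximable_sum indicator_space_L2) auto
    show "AE x in M. (\<lambda>m. s m x) \<longlonglongrightarrow> indicator (\<Union>i. A i) x"
      unfolding s by (intro AE_I2 LIMSEQ_indicator_UN)
    show "(s m x - indicator (\<Union>i. A i) x)\<^sup>2 \<le> 1" for m x
      unfolding s by (auto simp: indicator_def)
  qed (use subset_L2 UA in \<open>auto intro: indicator_space_L2\<close>)
qed

text \<open>Simple functions are dense in \<open>L\<^sup>2\<close>, and Dynkin's theorem reduces indicators to the generator.\<close>

lemma approximable_L2:
  assumes G: "Int_stable G" "G \<subseteq> Pow (space M)" "sets M = sigma_sets (space M) G"
    and gen: "\<And>A. A \<in> G \<Longrightarrow> L2_approximable M V (indicator A)"
    and f: "f \<in> space_L2 M"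
  shows "L2_approximable M V f"
proof -
  obtain F where F: "\<And>i. simple_function M (F i)"
    "\<And>x. x \<in> space M \<Longrightarrow> (\<lambda>i. F i x) \<longlonglongrightarrow> f x"
    "\<And>i x. x \<in> space M \<Longrightarrow> \<bar>F i x\<bar> \<le> 2 * \<bar>f x\<bar>"
    using borel_measurable_implies_sequence_metric[OF space_L2_measurable[OF f], of 0]
    by (simp add: dist_real_def) blast
  have rep: "(\<Sum>y\<in>F i ` space M. y * indicator (F i -` {y} \<inter> space M) x) = F i x"
    if "x \<in> space M" for i x
  proof -
    have "(\<Sum>y\<in>F i ` space M. y * indicator (F i -` {y} \<inter> space M) x)
        = (\<Sum>y\<in>F i ` space M. if y = F i x then y else 0)"
      using that by (intro sum.cong) (auto simp: indicator_def)
    also have "\<dots> = F i x"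
      using that simple_functionD(1)[OF F(1)] by (simp add: sum.delta')
    finally show ?thesis .
  qed
  have meas: "F i -` {y} \<inter> space M \<in> sets M" for i y
    using F(1) by (simp add: simple_functionD(2))
  let ?s = "\<lambda>i x. \<Sum>y\<in>F i ` space M. y * indicator (F i -` {y} \<inter> space M) x"
  show ?thesis
  \<comment> \<open>The simple functions are bounded by twice \<open>\<bar>f x\<bar>\<close>, so the
    error is at most three times it; hence the 9.\<close>
  proof (rule L2_approximable_limit_dominated[where s = ?s and w = "\<lambda>x. 9 * (f x)\<^sup>2"])
    show "?s m \<in> space_L2 M" for m
      by (intro space_L2_sum space_L2_scale indicator_space_L2 meas)
    show "L2_approximable M V (?s m)" for m
      by (intro approximable_sum approximable_scale space_L2_scale indicator_space_L2 meas
          approximable_indicator[OF G gen] simple_functionD(1)[OF F(1)])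
    show "AE x in M. (\<lambda>m. ?s m x) \<longlonglongrightarrow> f x"
      using F(2) by (intro AE_I2) (simp add: rep)
    show "(?s m x - f x)\<^sup>2 \<le> 9 * (f x)\<^sup>2" if "x \<in> space M" for m x
    proof -
      have "\<bar>F m x - f x\<bar> \<le> 3 * \<bar>f x\<bar>" using F(3)[OF that, of m] by linarith
      then have "\<bar>F m x - f x\<bar>\<^sup>2 \<le> (3 * \<bar>f x\<bar>)\<^sup>2" by (intro power_mono) auto
      then show ?thesis by (simp add: rep[OF that] power_mult_distrib)
    qed
    show "integrable M (\<lambda>x. 9 * (f x)\<^sup>2)" using space_L2_integrable[OF f] by simp
  qed (use subset_L2 f in auto)
qed

end

section \<open>The one-dimensional functionals as integrals\<close>

lemma bump_nonneg: "0 \<le> bump x"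
  by (simp add: bump_def)

text \<open>With \<open>t = 1 / (1 - x\<^sup>2)\<close> this is \<open>t \<le> exp t\<close>
  inverted. It is a majorant vanishing at the edge, as needed for
  \<open>continuous_bump\<close>.\<close>

lemma bump_le: "bump x \<le> 1 - x\<^sup>2" if "\<bar>x\<bar> < 1"
proof -
  have q: "0 < 1 - x\<^sup>2" using that by (simp add: abs_square_less_1)
  have "inverse (1 - x\<^sup>2) \<le> exp (inverse (1 - x\<^sup>2))"
    using exp_ge_add_one_self[of "inverse (1 - x\<^sup>2)"] by linarith
  then have "inverse (exp (inverse (1 - x\<^sup>2))) \<le> 1 - x\<^sup>2"
    using q by (metis inverse_inverse_eq inverse_positive_iff_positive le_imp_inverse_le)
  moreover have "1 / (\<bar>x\<bar>\<^sup>2 - 1) = - inverse (1 - x\<^sup>2)"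
    using q by (simp add: field_simps)
  ultimately show ?thesis using that by (simp add: bump_def exp_minus)
qed

text \<open>The formal derivative of \<open>bump\<close>. Its value 0 at 1 and -1 is a default;
  \<open>bump_deriv\<close> claims nothing there.\<close>

definition bump' :: "real \<Rightarrow> real" where
  "bump' x = (if \<bar>x\<bar> < 1 then - 2 * x / (x\<^sup>2 - 1)\<^sup>2 * exp (1 / (x\<^sup>2 - 1)) else 0)"

lemma bump_deriv:
  assumes "\<bar>x\<bar> \<noteq> 1"
  shows "(bump has_real_derivative bump' x) (at x)"
proof (cases "\<bar>x\<bar> < 1")
  case True
  have "x\<^sup>2 < 1" using True by (simp add: abs_square_less_1)
  then have "((\<lambda>x. exp (1 / (x\<^sup>2 - 1))) has_real_derivative bump' x) (at x)"
    using True by (auto intro!: derivative_eq_intros simp: bump'_def power2_eq_square)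
  then show ?thesis
  proof (rule has_field_derivative_transform_within_open[where S = "{-1<..<1}"])
    show "exp (1 / (y\<^sup>2 - 1)) = bump y" if "y \<in> {-1<..<1}" for y
      using that by (auto simp: bump_def abs_less_iff)
  qed (use True in auto)
next
  case False
  then have "((\<lambda>_. 0) has_real_derivative bump' x) (at x)"
    by (simp add: bump'_def)
  then show ?thesis
  proof (rule has_field_derivative_transform_within_open[where S = "{..<-1} \<union> {1<..}"])
    show "0 = bump y" if "y \<in> {..<-1} \<union> {1<..}" for y
      using that by (auto simp: bump_def abs_less_iff)
  qed (use False assms in auto)
qed

text \<open>Off the edge this is differentiability. At the edge \<open>bump\<close> is squeezed
  between 0 and \<open>\<bar>1 - y\<^sup>2\<bar>\<close>.\<close>

lemma continuous_bump: "isCont bump x"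
proof (cases "\<bar>x\<bar> = 1")
  case False
  then show ?thesis by (intro DERIV_isCont[OF bump_deriv])
next
  case True
  have sq: "x\<^sup>2 = 1" using True by (metis power2_abs one_power2)
  have le: "bump y \<le> \<bar>1 - y\<^sup>2\<bar>" for y
    using bump_le[of y] by (cases "\<bar>y\<bar> < 1") (auto simp: bump_def)
  have "(\<lambda>y. \<bar>1 - y\<^sup>2\<bar>) \<midarrow>x\<rightarrow> \<bar>1 - x\<^sup>2\<bar>"
    by (intro tendsto_intros)
  then have "(\<lambda>y. \<bar>1 - y\<^sup>2\<bar>) \<midarrow>x\<rightarrow> 0"
    by (simp only: sq) simp
  then have "bump \<midarrow>x\<rightarrow> 0"
    by (rule tendsto_sandwich[OF _ _ tendsto_const, rotated 2]) (simp_all add: bump_nonneg le)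
  moreover have "bump x = 0" using True by (simp add: bump_def)
  ultimately show ?thesis by (simp add: isCont_def)
qed

text \<open>With \<open>t = 1 / (1 - x\<^sup>2)\<close> the derivative is
  \<open>- 2 * x * (t\<^sup>2 * exp (- t))\<close>. The Taylor bound
  \<open>t\<^sup>2 / 2 \<le> exp t\<close> makes the last factor at most 2, and
  \<open>2 * \<bar>x\<bar>\<close> is at most 2.\<close>

lemma bump'_bounded: "\<bar>bump' x\<bar> \<le> 4"
proof (cases "\<bar>x\<bar> < 1")
  case True
  have q: "0 < 1 - x\<^sup>2" using True by (simp add: abs_square_less_1)
  define t where "t = inverse (1 - x\<^sup>2)"
  have t: "0 < t" using q by (simp add: t_def)
  have "t\<^sup>2 / 2 \<le> exp t" using exp_lower_Taylor_quadratic[of t] t by simp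
  then have "t\<^sup>2 * exp (- t) \<le> 2" by (simp add: exp_minus field_simps)
  moreover have "bump' x = - 2 * x * (t\<^sup>2 * exp (- t))"
  proof -
    have "1 / (x\<^sup>2 - 1) = - t" using q by (simp add: t_def field_simps)
    moreover have "1 / (x\<^sup>2 - 1)\<^sup>2 = t\<^sup>2"
      using q by (simp add: t_def power_inverse inverse_eq_divide power2_commute power_divide)
    ultimately show ?thesis using True unfolding bump'_def
      by (metis (no_types, lifting) mult.assoc times_divide_eq_right mult.right_neutral)
  qed
  ultimately have "\<bar>bump' x\<bar> = 2 * \<bar>x\<bar> * (t\<^sup>2 * exp (- t))" "t\<^sup>2 * exp (- t) \<le> 2"
    by (simp_all add: abs_mult)
  moreover have "2 * \<bar>x\<bar> * (t\<^sup>2 * exp (- t)) \<le> 2 * 2"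
    using True calculation(2) by (intro mult_mono) auto
  ultimately show ?thesis by simp
qed (simp add: bump'_def)

lemma borel_measurable_bump' [measurable]: "bump' \<in> borel_measurable borel"
  unfolding bump'_def by measurable

text \<open>The weights \<open>\<eta>\<^sub>l\<close> and \<open>\<eta>\<^sub>r\<close> are the cases \<open>c = 0\<close> and \<open>c = 1\<close>.\<close>

definition eta_at :: "real \<Rightarrow> real \<Rightarrow> real \<Rightarrow> real" where
  "eta_at \<rho> c x = (1 / \<rho>) * eta ((x - c) / \<rho>)"

definition eta_at' :: "real \<Rightarrow> real \<Rightarrow> real \<Rightarrow> real" where
  "eta_at' \<rho> c x = (1 / \<rho>\<^sup>2) * (bump' ((x - c) / \<rho>) / (LBINT t. bump t))"

lemma eta_at_l: "eta_l \<rho> = eta_at \<rho> 0" and eta_at_r: "eta_r \<rho> = eta_at \<rho> 1"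
  by (auto simp: eta_l_def eta_r_def eta_at_def)

locale interval =
  fixes \<rho> :: real
  assumes rho: "0 < \<rho>" "\<rho> \<le> 1 / 3"
begin

lemma interval_ne: "-\<rho> < 1 + \<rho>" using rho by linarith

lemma eta_at_deriv:
  assumes "x \<notin> {c - \<rho>, c + \<rho>}"
  shows "(eta_at \<rho> c has_real_derivative eta_at' \<rho> c x) (at x)"
proof -
  have "\<bar>(x - c) / \<rho>\<bar> \<noteq> 1"
    using assms rho by (auto simp: abs_if field_simps split: if_splits)
  then have "(bump has_real_derivative bump' ((x - c) / \<rho>)) (at ((x - c) / \<rho>))"
    by (rule bump_deriv)
  moreover have "((\<lambda>x. (x - c) / \<rho>) has_real_derivative 1 / \<rho>) (at x)"
    by (rule DERIV_cdivide) (auto intro!: derivative_eq_intros)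
  ultimately have "((\<lambda>x. bump ((x - c) / \<rho>)) has_real_derivative bump' ((x - c) / \<rho>) * (1 / \<rho>)) (at x)"
    by (rule DERIV_chain2)
  from DERIV_cmult[OF DERIV_cdivide[OF this, of "LBINT t. bump t"], of "1 / \<rho>"]
  show ?thesis unfolding eta_at_def[abs_def] eta_def eta_at'_def
    by (simp add: power2_eq_square mult.assoc)
qed

lemma continuous_eta_at: "continuous_on S (eta_at \<rho> c)"
proof -
  have "continuous_on UNIV bump"
    by (simp add: continuous_on_eq_continuous_at continuous_bump)
  moreover have "continuous_on S (\<lambda>x. (x - c) / \<rho>)"
    using rho by (auto intro!: continuous_intros)
  ultimately have "continuous_on S (\<lambda>x. bump ((x - c) / \<rho>))"
    by (rule continuous_on_compose2) simp
  then have "continuous_on S (\<lambda>x. (1 / \<rho> / (LBINT t. bump t)) * bump ((x - c) / \<rho>))"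
    by (rule continuous_on_mult_left)
  then show ?thesis by (simp add: eta_at_def[abs_def] eta_def)
qed

lemma eta_at_outside: "x \<notin> ball c \<rho> \<Longrightarrow> eta_at \<rho> c x = 0"
  using rho by (auto simp: eta_at_def eta_def bump_def dist_real_def abs_minus_commute)

lemma ball_subset: "ball 0 \<rho> \<subseteq> interval_I \<rho>" "ball 1 \<rho> \<subseteq> interval_I \<rho>"
  using rho by (auto simp: interval_I_def dist_real_def)

lemma sets_interval [simp]: "interval_I \<rho> \<in> sets borel"
  by (simp add: interval_I_def)

lemma space_leb_I [simp]: "space (leb_I \<rho>) = interval_I \<rho>"
  by (simp add: space_restrict_space)

lemma finite_measure_leb_I: "finite_measure (leb_I \<rho>)"
  using rho by (auto intro!: finite_measureI simp: emeasure_restrict_space interval_I_def)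

lemma C0_L2:
  assumes "continuous_on (interval_I \<rho>) f" shows "f \<in> space_L2 (leb_I \<rho>)"
proof -
  have "compact (f ` interval_I \<rho>)"
    using assms by (intro compact_continuous_image) (auto simp: interval_I_def)
  then obtain B where "\<And>x. x \<in> interval_I \<rho> \<Longrightarrow> \<bar>f x\<bar> \<le> B"
    by (force dest: compact_imp_bounded simp: bounded_iff)
  moreover have "f \<in> borel_measurable (leb_I \<rho>)"
    using borel_measurable_continuous_on_restrict[OF assms]
    by (simp cong: measurable_cong_sets sets_restrict_space_cong)
  ultimately show ?thesis
    by (intro space_L2_bounded[where B = B] finite_measure_leb_I) auto
qed

lemma C1_subset_C0: "C1_on S \<subseteq> C0_on S"
  unfolding C1_on_def C0_on_def using DERIV_continuous_on by blast

lemma C0_subset_L2: "C0_on (interval_I \<rho>) \<subseteq> space_L2 (leb_I \<rho>)"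
  using C0_L2 by (auto simp: C0_on_def)

lemma eta_at_L2: "eta_at \<rho> c \<in> space_L2 (leb_I \<rho>)"
  by (intro C0_L2 continuous_eta_at)

text \<open>Boundedness and measurability suffice on a finite measure space, so the behaviour of the
  derivative at the edge of the ball need not be studied.\<close>

lemma eta_at'_L2: "eta_at' \<rho> c \<in> space_L2 (leb_I \<rho>)"
proof -
  have "(\<lambda>x. bump' ((x - c) / \<rho>)) \<in> space_L2 (leb_I \<rho>)"
  proof (rule space_L2_bounded[OF finite_measure_leb_I])
    show "(\<lambda>x. bump' ((x - c) / \<rho>)) \<in> borel_measurable (leb_I \<rho>)"
      by (intro measurable_restrict_space1) simp
  qed (rule bump'_bounded)
  from space_L2_scale[OF this, of "1 / \<rho>\<^sup>2 / (LBINT t. bump t)"]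
  show ?thesis by (simp add: eta_at'_def[abs_def])
qed

section \<open>Integration by parts against the weights\<close>

lemma integral_leb_I:
  fixes f :: "real \<Rightarrow> real"
  shows "(\<integral>x. f x \<partial>leb_I \<rho>) = (LBINT x:interval_I \<rho>. f x)"
  unfolding set_lebesgue_integral_def by (rule integral_restrict_space) simp

text \<open>Moves the integrals of \<open>average\<close> from the balls to the whole interval; the
  weight supplies the vanishing outside.\<close>

lemma integral_ball_eq:
  fixes f g :: "real \<Rightarrow> real"
  assumes "ball c \<rho> \<subseteq> interval_I \<rho>" "\<And>x. x \<in> ball c \<rho> \<Longrightarrow> f x = g x" "\<And>x. x \<notin> ball c \<rho> \<Longrightarrow> g x = 0"
  shows "(LBINT x:ball c \<rho>. f x) = (\<integral>x. g x \<partial>leb_I \<rho>)"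
  unfolding integral_leb_I set_lebesgue_integral_def
  using assms by (intro Bochner_Integration.integral_cong) (auto simp: indicator_def)

text \<open>The exceptional set \<open>S\<close> is there for the two points
  \<open>c - \<rho>\<close> and \<open>c + \<rho>\<close>, where \<open>eta_at_deriv\<close> gives
  no derivative.\<close>

lemma FTC_leb_I:
  assumes F: "continuous_on (interval_I \<rho>) F" and S: "finite S"
    and deriv: "\<And>x. x \<in> {-\<rho><..<1+\<rho>} - S \<Longrightarrow> (F has_real_derivative f x) (at x)"
    and f: "integrable (leb_I \<rho>) f"
  shows "(\<integral>x. f x \<partial>leb_I \<rho>) = F (1 + \<rho>) - F (-\<rho>)"
proof -
  have "set_integrable lborel (interval_I \<rho>) f"
    using f by (simp add: integrable_restrict_space set_integrable_def)
  then have "(\<integral>x. f x \<partial>leb_I \<rho>) = integral (interval_I \<rho>) f"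
    unfolding integral_leb_I by (rule set_borel_integral_eq_integral)
  also have "(f has_integral (F (1 + \<rho>) - F (-\<rho>))) (interval_I \<rho>)"
    unfolding interval_I_def
  proof (rule fundamental_theorem_of_calculus_interior_strong[OF S])
    show "(F has_vector_derivative f x) (at x)" if "x \<in> {-\<rho><..<1+\<rho>} - S" for x
      using deriv[OF that] by (simp add: has_real_derivative_iff_has_vector_derivative)
  qed (use F interval_ne in \<open>auto simp: interval_I_def\<close>)
  then have "integral (interval_I \<rho>) f = F (1 + \<rho>) - F (-\<rho>)" by (rule integral_unique)
  finally show ?thesis .
qed

lemma integrable_mult_leb_I:
  assumes "f \<in> space_L2 (leb_I \<rho>)" "g \<in> space_L2 (leb_I \<rho>)"
  shows "integrable (leb_I \<rho>) (\<lambda>x. f x * g x)"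
  by (intro space_L2_mult_integrable assms)

text \<open>\<open>C1_on\<close> speaks of derivatives within the closed interval, whereas
  \<open>deriv\<close> in \<open>Ntilde0\<close> is the unrestricted derivative; they agree in the
  interior.\<close>

lemma deriv_at_interior:
  assumes "\<forall>x\<in>interval_I \<rho>. (u has_real_derivative u' x) (at x within interval_I \<rho>)" "x \<in> {-\<rho><..<1+\<rho>}"
  shows "(u has_real_derivative u' x) (at x)"
proof -
  have "(u has_real_derivative u' x) (at x within {-\<rho><..<1+\<rho>})"
    using assms by (auto simp: interval_I_def intro: DERIV_subset[where s = "{-\<rho>..1 + \<rho>}"])
  then show ?thesis using at_within_open[OF assms(2)] by simp
qed

lemma eta_at_parts_deriv:
  assumes c: "ball c \<rho> \<subseteq> interval_I \<rho>" and u': "continuous_on (interval_I \<rho>) u'"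
    and u: "\<forall>x\<in>interval_I \<rho>. (u has_real_derivative u' x) (at x within interval_I \<rho>)"
  shows "(\<integral>x. eta_at \<rho> c x * u' x \<partial>leb_I \<rho>) = (\<integral>x. (- eta_at' \<rho> c x) * u x \<partial>leb_I \<rho>)"
proof -
  have cu: "continuous_on (interval_I \<rho>) u"
    using u by (intro DERIV_continuous_on) auto
  \<comment> \<open>An open ball inside the interval lies in its interior, so the weight vanishes at
    both endpoints and no boundary terms remain.\<close>
  have outside: "-\<rho> \<notin> ball c \<rho>" "1 + \<rho> \<notin> ball c \<rho>"
  proof -
    have "x \<in> interior (interval_I \<rho>)" if "x \<in> ball c \<rho>" for x
      using c that by (meson interior_maximal open_ball subsetD)
    then show "-\<rho> \<notin> ball c \<rho>" "1 + \<rho> \<notin> ball c \<rho>" by (force simp: interval_I_def)+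
  qed
  have int: "integrable (leb_I \<rho>) (\<lambda>x. eta_at \<rho> c x * u' x)"
    "integrable (leb_I \<rho>) (\<lambda>x. eta_at' \<rho> c x * u x)"
    using u' cu by (auto intro!: integrable_mult_leb_I eta_at_L2 eta_at'_L2 C0_L2)
  have "(\<integral>x. eta_at' \<rho> c x * u x + eta_at \<rho> c x * u' x \<partial>leb_I \<rho>)
      = eta_at \<rho> c (1 + \<rho>) * u (1 + \<rho>) - eta_at \<rho> c (-\<rho>) * u (-\<rho>)"
  proof (rule FTC_leb_I[where S = "{c - \<rho>, c + \<rho>}"])
    show "continuous_on (interval_I \<rho>) (\<lambda>x. eta_at \<rho> c x * u x)"
      by (intro continuous_intros continuous_eta_at cu)
    show "((\<lambda>x. eta_at \<rho> c x * u x) has_real_derivative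
        eta_at' \<rho> c x * u x + eta_at \<rho> c x * u' x) (at x)"
      if "x \<in> {-\<rho><..<1+\<rho>} - {c - \<rho>, c + \<rho>}" for x
      using that by (auto intro!: derivative_eq_intros eta_at_deriv deriv_at_interior[OF u])
  qed (use int in auto)
  then have "(\<integral>x. eta_at' \<rho> c x * u x \<partial>leb_I \<rho>) + (\<integral>x. eta_at \<rho> c x * u' x \<partial>leb_I \<rho>) = 0"
    using int outside by (simp add: eta_at_outside)
  then show ?thesis by simp
qed

text \<open>Based at the left endpoint, so that it vanishes there and equals the full integral at
  the right endpoint.\<close>

definition primitive :: "(real \<Rightarrow> real) \<Rightarrow> real \<Rightarrow> real" where
  "primitive v x = integral {-\<rho>..x} v"

lemma primitive_deriv:
  assumes "continuous_on (interval_I \<rho>) v" "x \<in> interval_I \<rho>"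
  shows "(primitive v has_real_derivative v x) (at x within interval_I \<rho>)"
  using integral_has_real_derivative[of "-\<rho>" "1+\<rho>" v x] assms
  by (simp add: primitive_def[abs_def] interval_I_def)

lemma continuous_primitive:
  assumes "continuous_on (interval_I \<rho>) v"
  shows "continuous_on (interval_I \<rho>) (primitive v)"
  using primitive_deriv[OF assms] by (rule DERIV_continuous_on)

lemma primitive_end:
  assumes "continuous_on (interval_I \<rho>) v"
  shows "primitive v (1 + \<rho>) = (\<integral>x. v x \<partial>leb_I \<rho>)"
proof -
  have "set_integrable lborel (interval_I \<rho>) v"
    using assms by (auto intro!: borel_integrable_atLeastAtMost' simp: interval_I_def)
  then show ?thesis
    unfolding integral_leb_I primitive_def
    using set_borel_integral_eq_integral(2)[of "interval_I \<rho>" v] by (simp add: interval_I_def)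
qed

text \<open>Integration by parts with a primitive of each factor. The only boundary term is
  \<open>H (1 + \<rho>)\<close> times the integral of \<open>v\<close>, which merges with the
  remaining integral: the kernel is the mass of the weight to the right of \<open>x\<close>.\<close>

lemma eta_at_parts_primitive:
  fixes c :: real
  assumes v: "continuous_on (interval_I \<rho>) v"
  defines "H \<equiv> primitive (eta_at \<rho> c)"
  shows "(\<integral>x. eta_at \<rho> c x * primitive v x \<partial>leb_I \<rho>) = (\<integral>x. (H (1 + \<rho>) - H x) * v x \<partial>leb_I \<rho>)"
proof -
  note cH = continuous_primitive[OF continuous_eta_at[of _ c], folded H_def]
  note cV = continuous_primitive[OF v]
  have int: "integrable (leb_I \<rho>) (\<lambda>x. eta_at \<rho> c x * primitive v x)"
    "integrable (leb_I \<rho>) (\<lambda>x. H x * v x)" "integrable (leb_I \<rho>) v"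
    by (rule integrable_mult_leb_I[OF eta_at_L2] integrable_mult_leb_I
        space_L2_imp_integrable[OF finite_measure_leb_I] C0_L2 cH cV v)+
  have "(\<integral>x. eta_at \<rho> c x * primitive v x + H x * v x \<partial>leb_I \<rho>)
      = H (1 + \<rho>) * primitive v (1 + \<rho>) - H (-\<rho>) * primitive v (-\<rho>)"
  proof (rule FTC_leb_I[where S = "{}"])
    show "continuous_on (interval_I \<rho>) (\<lambda>x. H x * primitive v x)"
      by (intro continuous_intros cH cV)
    show "((\<lambda>x. H x * primitive v x) has_real_derivative
        eta_at \<rho> c x * primitive v x + H x * v x) (at x)" if "x \<in> {-\<rho><..<1+\<rho>} - {}" for x
      using that v unfolding H_def
      by (auto intro!: derivative_eq_intros deriv_at_interior primitive_deriv continuous_eta_at)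
  qed (use int in auto)
  moreover have "primitive v (-\<rho>) = 0" by (simp add: primitive_def)
  ultimately have "(\<integral>x. eta_at \<rho> c x * primitive v x \<partial>leb_I \<rho>)
      = H (1 + \<rho>) * (\<integral>x. v x \<partial>leb_I \<rho>) - (\<integral>x. H x * v x \<partial>leb_I \<rho>)"
    using int primitive_end[OF v] by simp
  also have "\<dots> = (\<integral>x. (H (1 + \<rho>) - H x) * v x \<partial>leb_I \<rho>)"
    using int by (simp add: left_diff_distrib)
  finally show ?thesis .
qed

section \<open>The averaged functionals as integrals against kernels\<close>

text \<open>Each functional is a term in \<open>yl\<close> plus a term in \<open>yr\<close>, so
  linearity of the iterated integral separates the two points; each term keeps the mass of the other
  weight as a factor.\<close>

lemma average_split:
  assumes N: "\<And>yl yr. yl \<in> ball 0 \<rho> \<Longrightarrow> yr \<in> ball 1 \<rho> \<Longrightarrow> N yl yr u = A yl + B yr"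
    and A: "A \<in> space_L2 (leb_I \<rho>)" and B: "B \<in> space_L2 (leb_I \<rho>)"
  shows "average \<rho> N u =
    (\<integral>y. eta_at \<rho> 1 y \<partial>leb_I \<rho>) * (\<integral>y. eta_at \<rho> 0 y * A y \<partial>leb_I \<rho>) +
    (\<integral>y. eta_at \<rho> 0 y \<partial>leb_I \<rho>) * (\<integral>y. eta_at \<rho> 1 y * B y \<partial>leb_I \<rho>)"
proof -
  let ?w0 = "eta_at \<rho> 0" and ?w1 = "eta_at \<rho> 1"
  have int: "integrable (leb_I \<rho>) ?w0" "integrable (leb_I \<rho>) ?w1"
    "integrable (leb_I \<rho>) (\<lambda>y. ?w0 y * A y)" "integrable (leb_I \<rho>) (\<lambda>y. ?w1 y * B y)"
    by (rule space_L2_imp_integrable[OF finite_measure_leb_I eta_at_L2]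
        integrable_mult_leb_I[OF eta_at_L2] A B)+
  let ?c = "\<integral>y. ?w1 y \<partial>leb_I \<rho>" and ?b = "\<integral>y. ?w1 y * B y \<partial>leb_I \<rho>"
  have inner: "(LBINT yr:ball 1 \<rho>. eta_l \<rho> yl * eta_r \<rho> yr * N yl yr u)
      = (?w0 yl * A yl) * ?c + ?w0 yl * ?b" if "yl \<in> ball 0 \<rho>" for yl
  proof -
    have "(LBINT yr:ball 1 \<rho>. eta_l \<rho> yl * eta_r \<rho> yr * N yl yr u)
        = (\<integral>yr. (?w0 yl * A yl) * ?w1 yr + ?w0 yl * (?w1 yr * B yr) \<partial>leb_I \<rho>)"
      using that by (intro integral_ball_eq ball_subset)
        (auto simp: N eta_at_l eta_at_r eta_at_outside algebra_simps)
    also have "\<dots> = (?w0 yl * A yl) * ?c + ?w0 yl * ?b"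
      using int by simp
    finally show ?thesis .
  qed
  have "average \<rho> N u = (\<integral>yl. (?w0 yl * A yl) * ?c + ?w0 yl * ?b \<partial>leb_I \<rho>)"
    unfolding average_def
    by (intro integral_ball_eq ball_subset) (auto simp: inner eta_at_outside)
  also have "\<dots> = ?c * (\<integral>y. ?w0 y * A y \<partial>leb_I \<rho>) + (\<integral>y. ?w0 y \<partial>leb_I \<rho>) * ?b"
    using int by simp
  finally show ?thesis .
qed

lemma average_kernel:
  assumes N: "\<And>yl yr. yl \<in> ball 0 \<rho> \<Longrightarrow> yr \<in> ball 1 \<rho> \<Longrightarrow> N yl yr u = a * A yl + b * A yr"
    and A: "A \<in> space_L2 (leb_I \<rho>)" and u: "u \<in> space_L2 (leb_I \<rho>)"
    and g: "\<And>c. g c \<in> space_L2 (leb_I \<rho>)"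
    and eq: "\<And>c. c \<in> {0, 1} \<Longrightarrow> (\<integral>y. eta_at \<rho> c y * A y \<partial>leb_I \<rho>) = (\<integral>y. g c y * u y \<partial>leb_I \<rho>)"
  shows "average \<rho> N u =
    (\<integral>y. ((\<integral>y. eta_at \<rho> 1 y \<partial>leb_I \<rho>) * a * g (0::real) y + (\<integral>y. eta_at \<rho> 0 y \<partial>leb_I \<rho>) * b * g 1 y) * u y \<partial>leb_I \<rho>)"
proof -
  let ?w0 = "eta_at \<rho> 0" and ?w1 = "eta_at \<rho> 1"
  have "average \<rho> N u =
    (\<integral>y. ?w1 y \<partial>leb_I \<rho>) * (\<integral>y. ?w0 y * (a * A y) \<partial>leb_I \<rho>) +
    (\<integral>y. ?w0 y \<partial>leb_I \<rho>) * (\<integral>y. ?w1 y * (b * A y) \<partial>leb_I \<rho>)"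
    using N A by (intro average_split space_L2_scale) auto
  also have "\<dots> = (\<integral>y. ?w1 y \<partial>leb_I \<rho>) * (a * (\<integral>y. g 0 y * u y \<partial>leb_I \<rho>)) +
    (\<integral>y. ?w0 y \<partial>leb_I \<rho>) * (b * (\<integral>y. g 1 y * u y \<partial>leb_I \<rho>))"
    by (simp add: mult.left_commute[of _ a] mult.left_commute[of _ b] eq)
  also have "\<dots> = (\<integral>y. ((\<integral>y. ?w1 y \<partial>leb_I \<rho>) * a) * (g 0 y * u y)
      + ((\<integral>y. ?w0 y \<partial>leb_I \<rho>) * b) * (g 1 y * u y) \<partial>leb_I \<rho>)"
    using g u by (simp add: integrable_mult_leb_I)
  finally show ?thesis by (simp add: algebra_simps)
qed

definition representable :: "(real \<Rightarrow> real) set \<Rightarrow> ((real \<Rightarrow> real) \<Rightarrow> real) \<Rightarrow> bool" where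
  "representable D N \<longleftrightarrow> (\<exists>g\<in>space_L2 (leb_I \<rho>). \<forall>u\<in>D. N u = (\<integral>y. g y * u y \<partial>leb_I \<rho>))"

text \<open>Common scheme for all functionals. \<open>A\<close> may depend on \<open>u\<close>: it
  is \<open>u\<close> itself, its derivative or its primitive. The kernel \<open>g c\<close> must
  not: it is what results when the operation is shifted from \<open>u\<close> to the weight at
  \<open>c\<close>.\<close>

lemma representableI:
  assumes D: "D \<subseteq> space_L2 (leb_I \<rho>)" and g: "\<And>c. g c \<in> space_L2 (leb_I \<rho>)"
    and A: "\<And>u. u \<in> D \<Longrightarrow> \<exists>A\<in>space_L2 (leb_I \<rho>).
      (\<forall>yl\<in>ball 0 \<rho>. \<forall>yr\<in>ball 1 \<rho>. N yl yr u = a * A yl + b * A yr) \<and>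
      (\<forall>c\<in>{0, 1}. (\<integral>y. eta_at \<rho> c y * A y \<partial>leb_I \<rho>) = (\<integral>y. g c y * u y \<partial>leb_I \<rho>))"
  shows "representable D (average \<rho> N)"
  unfolding representable_def
proof (intro bexI ballI)
  let ?g = "\<lambda>y. (\<integral>y. eta_at \<rho> 1 y \<partial>leb_I \<rho>) * a * g (0::real) y
    + (\<integral>y. eta_at \<rho> 0 y \<partial>leb_I \<rho>) * b * g 1 y"
  show "?g \<in> space_L2 (leb_I \<rho>)"
    using g by (intro space_L2_add space_L2_scale)
  fix u assume u: "u \<in> D"
  from A[OF this] obtain A where "A \<in> space_L2 (leb_I \<rho>)"
    "\<forall>yl\<in>ball 0 \<rho>. \<forall>yr\<in>ball 1 \<rho>. N yl yr u = a * A yl + b * A yr"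
    "\<forall>c\<in>{0, 1}. (\<integral>y. eta_at \<rho> c y * A y \<partial>leb_I \<rho>) = (\<integral>y. g c y * u y \<partial>leb_I \<rho>)" by blast
  then show "average \<rho> N u = (\<integral>y. ?g y * u y \<partial>leb_I \<rho>)"
    using g D u by (intro average_kernel[where A = A]) auto
qed

lemma average_point_representable:
  assumes "D \<subseteq> C0_on (interval_I \<rho>)" "\<And>yl yr u. N yl yr u = a * u yl + b * u yr"
  shows "representable D (average \<rho> N)"
proof (rule representableI[where g = "eta_at \<rho>" and a = a and b = b])
  show D: "D \<subseteq> space_L2 (leb_I \<rho>)" using assms C0_subset_L2 by blast
  show "\<exists>A\<in>space_L2 (leb_I \<rho>).
      (\<forall>yl\<in>ball 0 \<rho>. \<forall>yr\<in>ball 1 \<rho>. N yl yr u = a * A yl + b * A yr) \<and>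
      (\<forall>c\<in>{0, 1}. (\<integral>y. eta_at \<rho> c y * A y \<partial>leb_I \<rho>) = (\<integral>y. eta_at \<rho> c y * u y \<partial>leb_I \<rho>))"
    if "u \<in> D" for u
    using assms(2) D that by (intro bexI[of _ u]) auto
qed (rule eta_at_L2)

lemma average_deriv_representable:
  assumes "\<And>yl yr u. N yl yr u = a * deriv u yl + b * deriv u yr"
  shows "representable (C1_on (interval_I \<rho>)) (average \<rho> N)"
proof (rule representableI[where g = "\<lambda>c y. - eta_at' \<rho> c y" and a = a and b = b])
  show "C1_on (interval_I \<rho>) \<subseteq> space_L2 (leb_I \<rho>)" using C1_subset_C0 C0_subset_L2 by blast
  show "(\<lambda>y. - eta_at' \<rho> c y) \<in> space_L2 (leb_I \<rho>)" for c
    using space_L2_scale[OF eta_at'_L2, of "-1"] by simp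
  fix u assume "u \<in> C1_on (interval_I \<rho>)"
  then obtain u' where u': "continuous_on (interval_I \<rho>) u'"
    "\<forall>x\<in>interval_I \<rho>. (u has_real_derivative u' x) (at x within interval_I \<rho>)"
    by (auto simp: C1_on_def)
  have "deriv u y = u' y" if "y \<in> ball 0 \<rho> \<or> y \<in> ball 1 \<rho>" for y
    using that rho by (intro DERIV_imp_deriv deriv_at_interior[OF u'(2)]) (auto simp: dist_real_def)
  moreover have "(\<integral>y. eta_at \<rho> c y * u' y \<partial>leb_I \<rho>) = (\<integral>y. - eta_at' \<rho> c y * u y \<partial>leb_I \<rho>)"
    if "c \<in> {0, 1}" for c
    using that by (intro eta_at_parts_deriv u') (use ball_subset in auto)
  ultimately show "\<exists>A\<in>space_L2 (leb_I \<rho>).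
      (\<forall>yl\<in>ball 0 \<rho>. \<forall>yr\<in>ball 1 \<rho>. N yl yr u = a * A yl + b * A yr) \<and>
      (\<forall>c\<in>{0, 1}. (\<integral>y. eta_at \<rho> c y * A y \<partial>leb_I \<rho>) = (\<integral>y. - eta_at' \<rho> c y * u y \<partial>leb_I \<rho>))"
    using assms by (intro bexI[of _ u'] C0_L2 u'(1)) auto
qed

lemma interval_integral_primitive:
  assumes v: "continuous_on (interval_I \<rho>) v" and y: "yl \<in> ball 0 \<rho>" "yr \<in> ball 1 \<rho>"
  shows "(LBINT x=ereal yl..ereal yr. v x) = primitive v yr - primitive v yl"
proof (rule interval_integral_FTC_finite)
  have sub: "{min yl yr..max yl yr} \<subseteq> interval_I \<rho>"
    using y rho by (auto simp: interval_I_def dist_real_def)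
  show "continuous_on {min yl yr..max yl yr} v"
    using v sub by (rule continuous_on_subset)
  show "(primitive v has_vector_derivative v x) (at x within {min yl yr..max yl yr})"
    if "min yl yr \<le> x" "x \<le> max yl yr" for x
    using DERIV_subset[OF primitive_deriv[OF v] sub, of x] that sub
    by (auto simp: has_real_derivative_iff_has_vector_derivative)
qed

lemma average_integral_representable:
  assumes "\<And>yl yr v. N yl yr v = (LBINT x=ereal yl..ereal yr. v x)"
  shows "representable (C0_on (interval_I \<rho>)) (average \<rho> N)"
proof (rule representableI[where a = "-1" and b = 1 and
      g = "\<lambda>c y. primitive (eta_at \<rho> c) (1 + \<rho>) - primitive (eta_at \<rho> c) y"])
  show "(\<lambda>y. primitive (eta_at \<rho> c) (1 + \<rho>) - primitive (eta_at \<rho> c) y) \<in> space_L2 (leb_I \<rho>)" for c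
    by (intro C0_L2 continuous_intros continuous_primitive continuous_eta_at)
  fix v assume "v \<in> C0_on (interval_I \<rho>)"
  then have v: "continuous_on (interval_I \<rho>) v" by (simp add: C0_on_def)
  show "\<exists>A\<in>space_L2 (leb_I \<rho>).
      (\<forall>yl\<in>ball 0 \<rho>. \<forall>yr\<in>ball 1 \<rho>. N yl yr v = - 1 * A yl + 1 * A yr) \<and>
      (\<forall>c\<in>{0, 1}. (\<integral>y. eta_at \<rho> c y * A y \<partial>leb_I \<rho>) =
         (\<integral>y. (primitive (eta_at \<rho> c) (1 + \<rho>) - primitive (eta_at \<rho> c) y) * v y \<partial>leb_I \<rho>))"
    using eta_at_parts_primitive[OF v] interval_integral_primitive[OF v]
    by (intro bexI[of _ "primitive v"] C0_L2 continuous_primitive v) (auto simp: assms)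
qed (rule C0_subset_L2)

text \<open>No range is imposed on \<open>i\<close>, because the last branch of
  \<open>Ntilde0\<close> catches every other index; a kernel can then be chosen for all
  \<open>i\<close> at once.\<close>

lemma Ntilde0_representable: "representable (C1_on (interval_I \<rho>)) (average \<rho> (Ntilde0 i))"
proof -
  consider "i = 1" | "i = 2" | "i = 3" | "i \<notin> {1, 2, 3}" by blast
  then show ?thesis
  proof cases
    case 1
    then show ?thesis by (intro average_deriv_representable[where a = 1 and b = 0]) (simp add: Ntilde0_def)
  next
    case 2
    then show ?thesis by (intro average_deriv_representable[where a = 0 and b = 1]) (simp add: Ntilde0_def)
  next
    case 3
    then show ?thesis
      by (intro average_point_representable[where a = "-1" and b = 1] C1_subset_C0) (simp add: Ntilde0_def)
  next
    case 4
    then show ?thesis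
      by (intro average_point_representable[where a = 1 and b = 1] C1_subset_C0) (simp add: Ntilde0_def)
  qed
qed

lemma Ntilde1_representable: "representable (C0_on (interval_I \<rho>)) (average \<rho> (Ntilde1 i))"
proof -
  consider "i = 1" | "i = 2" | "i \<notin> {1, 2}" by blast
  then show ?thesis
  proof cases
    case 1
    then show ?thesis by (intro average_point_representable[where a = 1 and b = 0]) (auto simp: Ntilde1_def)
  next
    case 2
    then show ?thesis by (intro average_point_representable[where a = 0 and b = 1]) (auto simp: Ntilde1_def)
  next
    case 3
    then show ?thesis by (intro average_integral_representable) (simp add: Ntilde1_def)
  qed
qed

section \<open>Density of C1 functions and the continuous extension\<close>

lemma sets_leb_I: "sets (leb_I \<rho>) = sigma_sets (interval_I \<rho>) ((\<inter>) (interval_I \<rho>) ` range atMost)"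
proof -
  have borel: "sets borel = sigma_sets UNIV (range (atMost :: real \<Rightarrow> real set))"
    by (subst borel_eq_atMost) simp
  then have "interval_I \<rho> \<in> sigma_sets UNIV (range atMost)"
    using sets_interval by simp
  from sigma_sets_Int[OF this] show ?thesis
    using borel by (simp add: sets_restrict_space)
qed

text \<open>The rescaled arctangents \<open>s m\<close> take values between 0 and 1 and tend to 1
  left of \<open>a\<close> and to 0 right of it. At \<open>a\<close> they stay at 1/2, but a single
  point is a null set.\<close>

lemma indicator_approximable_C1:
  "L2_approximable (leb_I \<rho>) (C1_on (interval_I \<rho>)) (indicator (interval_I \<rho> \<inter> {..a}))"
proof -
  define s where "s m x = 1 / 2 - arctan (real m * (x - a)) / pi" for m x
  have C1: "s m \<in> C1_on (interval_I \<rho>)" for m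
    unfolding C1_on_def s_def
    by (auto intro!: exI[of _ "\<lambda>x. - (real m / (1 + (real m * (x - a))\<^sup>2)) / pi"] derivative_eq_intros
        continuous_intros simp: add_nonneg_eq_0_iff inverse_eq_divide)
  have sub: "C1_on (interval_I \<rho>) \<subseteq> space_L2 (leb_I \<rho>)" using C1_subset_C0 C0_subset_L2 by blast
  have range: "0 \<le> s m x" "s m x \<le> 1" for m x
    using arctan_bounded[of "real m * (x - a)"] by (auto simp: s_def field_simps)
  have lim: "(\<lambda>m. s m x) \<longlonglongrightarrow> indicator (interval_I \<rho> \<inter> {..a}) x" if x: "x \<noteq> a" "x \<in> interval_I \<rho>" for x
  proof (cases "x < a")
    case True
    have "filterlim (\<lambda>m. real m * (x - a)) at_bot sequentially"
      using True filterlim_real_sequentially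
      by (intro filterlim_tendsto_neg_mult_at_bot[OF tendsto_const, where c = "x - a", simplified mult.commute]) auto
    then have "(\<lambda>m. arctan (real m * (x - a))) \<longlonglongrightarrow> - (pi / 2)"
      by (rule filterlim_compose[OF tendsto_arctan_at_bot])
    then have "(\<lambda>m. s m x) \<longlonglongrightarrow> 1 / 2 - (- (pi / 2)) / pi"
      unfolding s_def by (intro tendsto_intros) auto
    then show ?thesis using True x by (simp add: indicator_def)
  next
    case False
    have "filterlim (\<lambda>m. real m * (x - a)) at_top sequentially"
      using False x filterlim_real_sequentially
      by (intro filterlim_at_top_mult_tendsto_pos[OF tendsto_const]) auto
    then have "(\<lambda>m. arctan (real m * (x - a))) \<longlonglongrightarrow> pi / 2"
      by (rule filterlim_compose[OF tendsto_arctan_at_top])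
    then have "(\<lambda>m. s m x) \<longlonglongrightarrow> 1 / 2 - (pi / 2) / pi"
      unfolding s_def by (intro tendsto_intros) auto
    then show ?thesis using False x by (simp add: indicator_def)
  qed
  show ?thesis
  proof (rule L2_approximable_limit_dominated[where s = s and w = "\<lambda>_. 1"])
    show "L2_approximable (leb_I \<rho>) (C1_on (interval_I \<rho>)) (s m)" for m
      using C1 by (rule L2_approximable_member) simp
    have "AE x in lborel. x \<noteq> a" by (rule AE_lborel_singleton)
    then have "AE x in leb_I \<rho>. x \<noteq> a"
      by (subst AE_restrict_space_iff) (auto elim: eventually_mono)
    then show "AE x in leb_I \<rho>. (\<lambda>m. s m x) \<longlonglongrightarrow> indicator (interval_I \<rho> \<inter> {..a}) x"
      using AE_space by eventually_elim (auto intro: lim)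
    show "(s m x - indicator (interval_I \<rho> \<inter> {..a}) x)\<^sup>2 \<le> 1" for m x
      using range[of m x] by (auto simp: indicator_def abs_square_le_1)
    show "indicator (interval_I \<rho> \<inter> {..a}) \<in> space_L2 (leb_I \<rho>)"
    proof (rule space_L2_bounded[OF finite_measure_leb_I])
      show "indicat_real (interval_I \<rho> \<inter> {..a}) \<in> borel_measurable (leb_I \<rho>)"
        by (intro measurable_restrict_space1 borel_measurable_indicator sets.Int) simp_all
      show "\<bar>indicat_real (interval_I \<rho> \<inter> {..a}) x\<bar> \<le> 1" for x by (simp add: indicator_def)
    qed
    show "integrable (leb_I \<rho>) (\<lambda>_. 1 :: real)"
      by (rule finite_measure.integrable_const[OF finite_measure_leb_I])
  qed (use C1 sub in auto)
qed

sublocale C1: L2_subspace "leb_I \<rho>" "C1_on (interval_I \<rho>)"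
proof (intro L2_subspace.intro L2_subspace_axioms.intro)
  show "finite_measure (leb_I \<rho>)" by (rule finite_measure_leb_I)
  show "C1_on (interval_I \<rho>) \<subseteq> space_L2 (leb_I \<rho>)" using C1_subset_C0 C0_subset_L2 by blast
  show "(\<lambda>_. 1) \<in> C1_on (interval_I \<rho>)"
    by (auto simp: C1_on_def intro!: exI[of _ "\<lambda>_. 0"] continuous_intros)
  fix u v :: "real \<Rightarrow> real" and c
  assume "u \<in> C1_on (interval_I \<rho>)"
  then obtain u' where u': "continuous_on (interval_I \<rho>) u'"
    "\<forall>x\<in>interval_I \<rho>. (u has_real_derivative u' x) (at x within interval_I \<rho>)"
    by (auto simp: C1_on_def)
  then show "(\<lambda>x. c * u x) \<in> C1_on (interval_I \<rho>)"
    by (auto simp: C1_on_def intro!: exI[of _ "\<lambda>x. c * u' x"] continuous_intros derivative_eq_intros)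
  assume "v \<in> C1_on (interval_I \<rho>)"
  then obtain v' where v': "continuous_on (interval_I \<rho>) v'"
    "\<forall>x\<in>interval_I \<rho>. (v has_real_derivative v' x) (at x within interval_I \<rho>)"
    by (auto simp: C1_on_def)
  with u' show "(\<lambda>x. u x + v x) \<in> C1_on (interval_I \<rho>)"
    by (auto simp: C1_on_def intro!: exI[of _ "\<lambda>x. u' x + v' x"] continuous_intros derivative_eq_intros)
qed

lemma C1_dense:
  assumes "f \<in> space_L2 (leb_I \<rho>)"
  shows "L2_approximable (leb_I \<rho>) (C1_on (interval_I \<rho>)) f"
proof (rule C1.approximable_L2[where G = "(\<inter>) (interval_I \<rho>) ` range atMost"])
  show "Int_stable ((\<inter>) (interval_I \<rho>) ` range atMost)"
  proof (rule Int_stableI)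
    fix A B assume "A \<in> (\<inter>) (interval_I \<rho>) ` range atMost" "B \<in> (\<inter>) (interval_I \<rho>) ` range atMost"
    then obtain a b where "A = interval_I \<rho> \<inter> {..a}" "B = interval_I \<rho> \<inter> {..b}" by blast
    then have "A \<inter> B = interval_I \<rho> \<inter> {..min a b}" by auto
    then show "A \<inter> B \<in> (\<inter>) (interval_I \<rho>) ` range atMost" by blast
  qed
qed (use assms in \<open>auto simp: sets_leb_I indicator_approximable_C1\<close>)

text \<open>Cauchy-Schwarz shows that the kernel integral is the limit along every admissible
  sequence. Density of C1 supplies one such sequence, so no other number satisfies the condition
  under \<open>THE\<close>.\<close>

lemma extend_L2_representable:
  assumes D: "C1_on (interval_I \<rho>) \<subseteq> D" "D \<subseteq> space_L2 (leb_I \<rho>)" and N: "representable D N"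
  shows "\<exists>g\<in>space_L2 (leb_I \<rho>). \<forall>u\<in>space_L2 (leb_I \<rho>). extend_L2 \<rho> D N u = (\<integral>y. g y * u y \<partial>leb_I \<rho>)"
proof -
  obtain g where g: "g \<in> space_L2 (leb_I \<rho>)" "\<And>u. u \<in> D \<Longrightarrow> N u = (\<integral>y. g y * u y \<partial>leb_I \<rho>)"
    using N by (auto simp: representable_def)
  have "extend_L2 \<rho> D N u = (\<integral>y. g y * u y \<partial>leb_I \<rho>)" if u: "u \<in> space_L2 (leb_I \<rho>)" for u
    unfolding extend_L2_def
  proof (rule the_equality)
    let ?c = "\<integral>y. g y * u y \<partial>leb_I \<rho>"
    have conv: "(\<lambda>m. N (s m)) \<longlonglongrightarrow> ?c"
      if s: "\<And>m. s m \<in> D" and lim: "(\<lambda>m. \<integral>x. (s m x - u x)\<^sup>2 \<partial>leb_I \<rho>) \<longlonglongrightarrow> 0" for s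
    proof -
      have s': "s m \<in> space_L2 (leb_I \<rho>)" for m using s D by auto
      have le: "(N (s m) - ?c)\<^sup>2 \<le> (\<integral>x. (g x)\<^sup>2 \<partial>leb_I \<rho>) * (\<integral>x. (s m x - u x)\<^sup>2 \<partial>leb_I \<rho>)" for m
      proof -
        have "N (s m) - ?c = (\<integral>y. g y * (s m y - u y) \<partial>leb_I \<rho>)"
          using g u s' s by (simp add: right_diff_distrib integrable_mult_leb_I)
        then show ?thesis using L2_Cauchy_Schwarz[OF g(1) space_L2_diff[OF s'[of m] u]] by simp
      qed
      have "(\<lambda>m. (N (s m) - ?c)\<^sup>2) \<longlonglongrightarrow> 0"
        by (rule LIMSEQ_squeeze_0[OF tendsto_mult_right_zero[OF lim] zero_le_power2 le])
      then have "(\<lambda>m. N (s m) - ?c) \<longlonglongrightarrow> 0"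
        using tendsto_real_sqrt by (fastforce simp: tendsto_rabs_zero_iff)
      then show ?thesis by (simp add: LIM_zero_iff)
    qed
    then show "\<forall>s. (\<forall>m. s m \<in> D) \<and> (\<lambda>m. \<integral>x. (s m x - u x)\<^sup>2 \<partial>leb_I \<rho>) \<longlonglongrightarrow> 0 \<longrightarrow>
        (\<lambda>m. N (s m)) \<longlonglongrightarrow> ?c" by blast
    obtain s where "\<And>m. s m \<in> C1_on (interval_I \<rho>)"
      "(\<lambda>m. \<integral>x. (s m x - u x)\<^sup>2 \<partial>leb_I \<rho>) \<longlonglongrightarrow> 0"
      using L2_approximable_sequence[OF C1_dense[OF u]] by blast
    then have s: "\<And>m. s m \<in> D" "(\<lambda>m. \<integral>x. (s m x - u x)\<^sup>2 \<partial>leb_I \<rho>) \<longlonglongrightarrow> 0"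
      using D by auto
    fix c assume "\<forall>s. (\<forall>m. s m \<in> D) \<and> (\<lambda>m. \<integral>x. (s m x - u x)\<^sup>2 \<partial>leb_I \<rho>) \<longlonglongrightarrow> 0 \<longrightarrow>
        (\<lambda>m. N (s m)) \<longlonglongrightarrow> c"
    with s have "(\<lambda>m. N (s m)) \<longlonglongrightarrow> c" by blast
    from this conv[OF s] show "c = ?c" by (rule LIMSEQ_unique)
  qed
  with g(1) show ?thesis by blast
qed

text \<open>One family for both degrees; every nonzero \<open>d\<close> shares the kernels of degree
  1, matching the case split on \<open>d = 0\<close> in \<open>proj\<close>.\<close>

lemma Nbar_kernel:
  obtains g where "\<And>d i. g d i \<in> space_L2 (leb_I \<rho>)"
    "\<And>i u. u \<in> space_L2 (leb_I \<rho>) \<Longrightarrow> Nbar0 \<rho> i u = (\<integral>y. g (0::nat) i y * u y \<partial>leb_I \<rho>)"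
    "\<And>d i u. u \<in> space_L2 (leb_I \<rho>) \<Longrightarrow> d \<noteq> 0 \<Longrightarrow> Nbar1 \<rho> i u = (\<integral>y. g d i y * u y \<partial>leb_I \<rho>)"
proof -
  have "\<exists>g\<in>space_L2 (leb_I \<rho>). \<forall>u\<in>space_L2 (leb_I \<rho>). Nbar0 \<rho> i u = (\<integral>y. g y * u y \<partial>leb_I \<rho>)" for i
    unfolding Nbar0_def using C1_subset_C0 C0_subset_L2
    by (intro extend_L2_representable Ntilde0_representable) blast+
  then obtain g0 where g0: "\<And>i. g0 i \<in> space_L2 (leb_I \<rho>)"
    "\<And>i u. u \<in> space_L2 (leb_I \<rho>) \<Longrightarrow> Nbar0 \<rho> i u = (\<integral>y. g0 i y * u y \<partial>leb_I \<rho>)" by metis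
  have "\<exists>g\<in>space_L2 (leb_I \<rho>). \<forall>u\<in>space_L2 (leb_I \<rho>). Nbar1 \<rho> i u = (\<integral>y. g y * u y \<partial>leb_I \<rho>)" for i
    unfolding Nbar1_def using C1_subset_C0 C0_subset_L2
    by (intro extend_L2_representable Ntilde1_representable) blast+
  then obtain g1 where g1: "\<And>i. g1 i \<in> space_L2 (leb_I \<rho>)"
    "\<And>i u. u \<in> space_L2 (leb_I \<rho>) \<Longrightarrow> Nbar1 \<rho> i u = (\<integral>y. g1 i y * u y \<partial>leb_I \<rho>)" by metis
  show ?thesis
    using g0 g1 by (intro that[of "\<lambda>d. if d = 0 then g0 else g1"]) auto
qed

end

section \<open>Tensor products\<close>

lemma sum_list_distinct_delta:
  fixes f :: "'a \<Rightarrow> real"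
  assumes "distinct xs" "a \<in> set xs"
  shows "(\<Sum>x\<leftarrow>xs. if a = x then f x else 0) = f a"
  using assms by (simp add: sum_list_distinct_conv_sum_set)

lemma finite_multi: "finite (multi n)"
  unfolding multi_def by (intro finite_PiE) auto

lemma chi_subset_multi: "chi n k \<subseteq> multi n"
  by (auto simp: chi_def)

lemma multi_eqI:
  assumes "i \<in> multi n" "l \<in> multi n" "\<And>j. j < n \<Longrightarrow> i j = l j"
  shows "i = l"
  using assms unfolding multi_def by (intro PiE_ext[of _ "{..<n}" "\<lambda>_. {0, 1}"]) auto

text \<open>If \<open>l\<close> and \<open>i\<close> differ in some coordinate, the factor there is
  zero; pure tensors therefore sit in a single component.\<close>

lemma tensor_pure_form:
  assumes "i \<in> multi n" "l \<in> multi n"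
  shows "tensor n (\<lambda>j. pure_form (i j) (f j)) l x = (if l = i then \<Prod>j<n. f j (x j) else 0)"
proof (cases "l = i")
  case False
  then obtain j where "j < n" "l j \<noteq> i j" using multi_eqI[OF assms] by metis
  then have "(\<Prod>j<n. pure_form (i j) (f j) (l j) (x j)) = 0"
    by (intro prod_zero) (auto simp: pure_form_def)
  then show ?thesis using False by (simp add: tensor_def)
qed (simp add: tensor_def pure_form_def)

text \<open>Since \<open>multi n\<close> is finite, all convergence questions for forms can be
  treated one component at a time.\<close>

lemma norm_L2_tendsto_0:
  "(\<lambda>m. norm_L2 \<rho> n (F m)) \<longlonglongrightarrow> 0 \<longleftrightarrow>
     (\<forall>i\<in>multi n. (\<lambda>m. \<integral>x. (F m i x)\<^sup>2 \<partial>leb_cube \<rho> n) \<longlonglongrightarrow> 0)"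
proof
  assume lim: "(\<lambda>m. norm_L2 \<rho> n (F m)) \<longlonglongrightarrow> 0"
  have sq: "(norm_L2 \<rho> n (F m))\<^sup>2 = (\<Sum>i\<in>multi n. \<integral>x. (F m i x)\<^sup>2 \<partial>leb_cube \<rho> n)" for m
    unfolding norm_L2_def by (intro real_sqrt_pow2 sum_nonneg) simp
  show "\<forall>i\<in>multi n. (\<lambda>m. \<integral>x. (F m i x)\<^sup>2 \<partial>leb_cube \<rho> n) \<longlonglongrightarrow> 0"
  proof
    fix i assume i: "i \<in> multi n"
    show "(\<lambda>m. \<integral>x. (F m i x)\<^sup>2 \<partial>leb_cube \<rho> n) \<longlonglongrightarrow> 0"
    proof (rule LIMSEQ_squeeze_0)
      show "(\<lambda>m. (norm_L2 \<rho> n (F m))\<^sup>2) \<longlonglongrightarrow> 0"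
        using tendsto_power[OF lim, of 2] by simp
      show "(\<integral>x. (F m i x)\<^sup>2 \<partial>leb_cube \<rho> n) \<le> (norm_L2 \<rho> n (F m))\<^sup>2" for m
        unfolding sq by (rule member_le_sum[OF i _ finite_multi]) simp
    qed simp
  qed
next
  assume lim: "\<forall>i\<in>multi n. (\<lambda>m. \<integral>x. (F m i x)\<^sup>2 \<partial>leb_cube \<rho> n) \<longlonglongrightarrow> 0"
  have "(\<lambda>m. \<Sum>i\<in>multi n. \<integral>x. (F m i x)\<^sup>2 \<partial>leb_cube \<rho> n) \<longlonglongrightarrow> (\<Sum>i\<in>multi n. 0)"
    by (intro tendsto_sum) (use lim in auto)
  from tendsto_real_sqrt[OF this] show "(\<lambda>m. norm_L2 \<rho> n (F m)) \<longlonglongrightarrow> 0"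
    by (simp add: norm_L2_def)
qed

section \<open>Density of sums of elementary tensors on the cube\<close>

text \<open>The algebraic tensor product in one component. Lists without scalar coefficients match
  the sums in \<open>is_tensor_op_value\<close>.\<close>

definition product_span :: "real \<Rightarrow> nat \<Rightarrow> ((nat \<Rightarrow> real) \<Rightarrow> real) set" where
  "product_span \<rho> n = {\<lambda>x. \<Sum>f\<leftarrow>fs. \<Prod>j<n. f j (x j) |fs.
     \<forall>f\<in>set fs. \<forall>j<n. f j \<in> space_L2 (leb_I \<rho>)}"

context interval begin

lemma product_sigma_finite_leb_I: "product_sigma_finite (\<lambda>_::nat. leb_I \<rho>)"
  by (simp add: product_sigma_finite_def C1.sigma_finite_measure_axioms)

lemma finite_measure_cube: "finite_measure (leb_cube \<rho> n)"
proof
  have "emeasure (leb_cube \<rho> n) (space (leb_cube \<rho> n))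
      = (\<Prod>j<n. emeasure (leb_I \<rho>) (space (leb_I \<rho>)))"
    unfolding space_PiM
    by (intro product_sigma_finite.emeasure_PiM[OF product_sigma_finite_leb_I] sets.top) simp
  also have "\<dots> < \<infinity>"
    using C1.emeasure_finite[of "interval_I \<rho>"]
    by (simp add: power_eq_top_ennreal less_top[symmetric])
  finally show "emeasure (leb_cube \<rho> n) (space (leb_cube \<rho> n)) \<noteq> \<infinity>" by simp
qed

lemma product_L2:
  assumes "\<And>j. j < n \<Longrightarrow> f j \<in> space_L2 (leb_I \<rho>)"
  shows "(\<lambda>x. \<Prod>j<n. f j (x j)) \<in> space_L2 (leb_cube \<rho> n)"
proof -
  have "(\<lambda>x. \<Prod>j<n. f j (x j)) \<in> borel_measurable (leb_cube \<rho> n)"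
    using assms
    by (intro borel_measurable_prod measurable_compose[OF measurable_component_singleton])
      (auto dest: space_L2_measurable)
  moreover have "integrable (leb_cube \<rho> n) (\<lambda>x. \<Prod>j<n. (f j (x j))\<^sup>2)"
    using assms
    by (intro product_sigma_finite.product_integrable_prod[OF product_sigma_finite_leb_I,
          where f = "\<lambda>j y. (f j y)\<^sup>2"] space_L2_integrable) auto
  ultimately show ?thesis by (simp add: space_L2_def prod_power_distrib)
qed

lemma L2_subspace_product_span:
  assumes "1 \<le> n"
  shows "L2_subspace (leb_cube \<rho> n) (product_span \<rho> n)"
proof (intro L2_subspace.intro L2_subspace_axioms.intro finite_measure_cube)
  show "product_span \<rho> n \<subseteq> space_L2 (leb_cube \<rho> n)"
    by (auto simp: product_span_def intro!: space_L2_sum_list product_L2)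
  have "(\<lambda>_. 1) \<in> space_L2 (leb_I \<rho>)"
    by (intro C0_L2 continuous_intros)
  then show "(\<lambda>_. 1) \<in> product_span \<rho> n"
    unfolding product_span_def by (auto intro!: exI[of _ "[\<lambda>_ _. 1]"])
  fix u v :: "(nat \<Rightarrow> real) \<Rightarrow> real" and c
  assume "u \<in> product_span \<rho> n"
  then obtain fs where fs: "u = (\<lambda>x. \<Sum>f\<leftarrow>fs. \<Prod>j<n. f j (x j))"
    "\<forall>f\<in>set fs. \<forall>j<n. f j \<in> space_L2 (leb_I \<rho>)" by (auto simp: product_span_def)
  \<comment> \<open>The scalar goes into factor 0, which exists because \<open>1 \<le> n\<close>.
    For \<open>n = 0\<close> every product is 1 and the span would contain only natural
    numbers.\<close>
  define h where "h f = f(0 := \<lambda>y. c * f 0 y)" for f :: "nat \<Rightarrow> real \<Rightarrow> real"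
  have h: "(\<Prod>j<n. h f j (x j)) = c * (\<Prod>j<n. f j (x j))" for f x
    using assms by (simp add: h_def prod.remove[of "{..<n}" 0])
  have "\<forall>f\<in>set (map h fs). \<forall>j<n. f j \<in> space_L2 (leb_I \<rho>)"
    using fs(2) by (auto simp: h_def intro: space_L2_scale)
  moreover have "(\<lambda>x. c * u x) = (\<lambda>x. \<Sum>f\<leftarrow>map h fs. \<Prod>j<n. f j (x j))"
    by (simp add: fs(1) o_def h sum_list_const_mult)
  ultimately show "(\<lambda>x. c * u x) \<in> product_span \<rho> n"
    unfolding product_span_def by blast
  assume "v \<in> product_span \<rho> n"
  then obtain gs where gs: "v = (\<lambda>x. \<Sum>f\<leftarrow>gs. \<Prod>j<n. f j (x j))"
    "\<forall>f\<in>set gs. \<forall>j<n. f j \<in> space_L2 (leb_I \<rho>)" by (auto simp: product_span_def)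
  have "\<forall>f\<in>set (fs @ gs). \<forall>j<n. f j \<in> space_L2 (leb_I \<rho>)" using fs gs by auto
  moreover have "(\<lambda>x. u x + v x) = (\<lambda>x. \<Sum>f\<leftarrow>fs @ gs. \<Prod>j<n. f j (x j))"
    by (simp add: fs(1) gs(1))
  ultimately show "(\<lambda>x. u x + v x) \<in> product_span \<rho> n"
    unfolding product_span_def by blast
qed

text \<open>Measurable boxes are stable under intersection and generate the product sigma-algebra,
  and the indicator of a box is itself a product of one-variable indicators.\<close>

lemma product_span_dense:
  assumes n: "1 \<le> n" and f: "f \<in> space_L2 (leb_cube \<rho> n)"
  shows "L2_approximable (leb_cube \<rho> n) (product_span \<rho> n) f"
proof (rule L2_subspace.approximable_L2[OF L2_subspace_product_span[OF n] Int_stable_prod_algebra])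
  show "prod_algebra {..<n} (\<lambda>_. leb_I \<rho>) \<subseteq> Pow (space (leb_cube \<rho> n))"
    using prod_algebra_sets_into_space[of "{..<n}" "\<lambda>_. leb_I \<rho>"] by (simp only: space_PiM)
  show "sets (leb_cube \<rho> n) = sigma_sets (space (leb_cube \<rho> n)) (prod_algebra {..<n} (\<lambda>_. leb_I \<rho>))"
    by (simp only: sets_PiM space_PiM)
  fix A assume "A \<in> prod_algebra {..<n} (\<lambda>_. leb_I \<rho>)"
  then obtain X where X: "A = (\<Pi>\<^sub>E j\<in>{..<n}. X j)" "\<And>j. j < n \<Longrightarrow> X j \<in> sets (leb_I \<rho>)"
    by (auto simp: prod_algebra_eq_finite)
  show "L2_approximable (leb_cube \<rho> n) (product_span \<rho> n) (indicator A)"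
  proof (rule L2_approximable_member)
    show "(\<lambda>x. \<Sum>f\<leftarrow>[\<lambda>j. indicator (X j)]. \<Prod>j<n. f j (x j)) \<in> product_span \<rho> n"
      unfolding product_span_def using C1.indicator_space_L2 X(2)
      by (intro CollectI exI[of _ "[\<lambda>j. indicator (X j)]"]) simp
    show "(\<Sum>f\<leftarrow>[\<lambda>j. indicator (X j)]. \<Prod>j<n. f j (x j)) = indicat_real A x"
      if "x \<in> space (leb_cube \<rho> n)" for x
    proof (cases "x \<in> A")
      case True
      then show ?thesis by (auto simp: X(1) indicator_def PiE_iff intro!: prod.neutral)
    next
      case False
      \<comment> \<open>Extensionality leaves only one way to miss the box, namely in a coordinate
        below \<open>n\<close>.\<close>
      moreover have "x \<in> extensional {..<n}"
        using that by (simp add: space_PiM PiE_def)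
      ultimately obtain j where "j < n" "x j \<notin> X j"
        by (auto simp: X(1) PiE_iff)
      then have "(\<Prod>j<n. indicat_real (X j) (x j)) = 0" by (intro prod_zero bexI[of _ j]) auto
      then show ?thesis using False by simp
    qed
  qed
qed (rule f)

lemma tensor_L2:
  assumes "i \<in> multi n" "\<And>j. j < n \<Longrightarrow> v j \<in> L2_form1 \<rho>"
  shows "tensor n v i \<in> space_L2 (leb_cube \<rho> n)"
  unfolding tensor_def
proof (rule product_L2)
  fix j assume j: "j < n"
  then have "i j \<in> {0, 1}" using assms(1) by (auto simp: multi_def PiE_iff)
  then show "v j (i j) \<in> space_L2 (leb_I \<rho>)"
    using assms(2)[OF j] by (auto simp: L2_form1_def)
qed

text \<open>Each component is approximated separately by sums of products. Read as pure forms, these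
  can be put into one list without disturbing each other, by
  \<open>tensor_pure_form\<close>.\<close>

lemma tensors_dense:
  assumes n: "1 \<le> n" and u: "u \<in> L2_forms \<rho> n"
  obtains s where "\<And>m v j. v \<in> set (s m) \<Longrightarrow> j < n \<Longrightarrow> v j \<in> L2_form1 \<rho>"
    "(\<lambda>m. norm_L2 \<rho> n (\<lambda>i x. (\<Sum>v\<leftarrow>s m. tensor n v i x) - u i x)) \<longlonglongrightarrow> 0"
proof -
  have "\<exists>fs. (\<forall>m. \<forall>f\<in>set (fs m). \<forall>j<n. f j \<in> space_L2 (leb_I \<rho>)) \<and>
      (\<lambda>m. \<integral>x. ((\<Sum>f\<leftarrow>fs m. \<Prod>j<n. f j (x j)) - u i x)\<^sup>2 \<partial>leb_cube \<rho> n) \<longlonglongrightarrow> 0"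
    if "i \<in> multi n" for i
  proof -
    have "u i \<in> space_L2 (leb_cube \<rho> n)" using u that by (simp add: L2_forms_def)
    from L2_approximable_sequence[OF product_span_dense[OF n this]]
    obtain s where s: "\<And>m. s m \<in> product_span \<rho> n"
      "(\<lambda>m. \<integral>x. (s m x - u i x)\<^sup>2 \<partial>leb_cube \<rho> n) \<longlonglongrightarrow> 0" by blast
    have "\<exists>fs. s m = (\<lambda>x. \<Sum>f\<leftarrow>fs. \<Prod>j<n. f j (x j)) \<and>
        (\<forall>f\<in>set fs. \<forall>j<n. f j \<in> space_L2 (leb_I \<rho>))" for m
      using s(1)[of m] by (auto simp: product_span_def)
    then obtain fs where "\<And>m. s m = (\<lambda>x. \<Sum>f\<leftarrow>fs m. \<Prod>j<n. f j (x j))"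
      "\<And>m. \<forall>f\<in>set (fs m). \<forall>j<n. f j \<in> space_L2 (leb_I \<rho>)" by metis
    with s(2) show ?thesis by (intro exI[of _ fs]) simp
  qed
  then have "\<forall>i\<in>multi n. \<exists>fs. (\<forall>m. \<forall>f\<in>set (fs m). \<forall>j<n. f j \<in> space_L2 (leb_I \<rho>)) \<and>
      (\<lambda>m. \<integral>x. ((\<Sum>f\<leftarrow>fs m. \<Prod>j<n. f j (x j)) - u i x)\<^sup>2 \<partial>leb_cube \<rho> n) \<longlonglongrightarrow> 0"
    by (rule ballI)
  then obtain fs where "\<forall>i\<in>multi n. (\<forall>m. \<forall>f\<in>set (fs i m). \<forall>j<n. f j \<in> space_L2 (leb_I \<rho>)) \<and>
      (\<lambda>m. \<integral>x. ((\<Sum>f\<leftarrow>fs i m. \<Prod>j<n. f j (x j)) - u i x)\<^sup>2 \<partial>leb_cube \<rho> n) \<longlonglongrightarrow> 0"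
    by (rule bchoice[THEN exE])
  then have fs: "\<And>i m f j. i \<in> multi n \<Longrightarrow> f \<in> set (fs i m) \<Longrightarrow> j < n \<Longrightarrow> f j \<in> space_L2 (leb_I \<rho>)"
    "\<And>i. i \<in> multi n \<Longrightarrow>
      (\<lambda>m. \<integral>x. ((\<Sum>f\<leftarrow>fs i m. \<Prod>j<n. f j (x j)) - u i x)\<^sup>2 \<partial>leb_cube \<rho> n) \<longlonglongrightarrow> 0"
    by simp_all
  obtain js where js: "set js = multi n" "distinct js"
    using finite_distinct_list[OF finite_multi] by blast
  define s where "s m = concat (map (\<lambda>i. map (\<lambda>f j. pure_form (i j) (f j)) (fs i m)) js)" for m
  have sum: "(\<Sum>v\<leftarrow>s m. tensor n v l x) = (\<Sum>f\<leftarrow>fs l m. \<Prod>j<n. f j (x j))"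
    if l: "l \<in> multi n" for m l x
  proof -
    have "(\<Sum>v\<leftarrow>s m. tensor n v l x)
        = (\<Sum>i\<leftarrow>js. \<Sum>f\<leftarrow>fs i m. tensor n (\<lambda>j. pure_form (i j) (f j)) l x)"
      unfolding s_def by (induction js) (simp_all add: o_def)
    also have "\<dots> = (\<Sum>i\<leftarrow>js. if l = i then \<Sum>f\<leftarrow>fs i m. \<Prod>j<n. f j (x j) else 0)"
      using js(1) l by (intro arg_cong[of _ _ sum_list] map_cong refl) (auto simp: tensor_pure_form)
    also have "\<dots> = (\<Sum>f\<leftarrow>fs l m. \<Prod>j<n. f j (x j))"
      using js l by (intro sum_list_distinct_delta) auto
    finally show ?thesis .
  qed
  show ?thesis
  proof (rule that)
    show "v j \<in> L2_form1 \<rho>" if "v \<in> set (s m)" "j < n" for v m j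
      using that js fs(1) by (auto simp: s_def L2_form1_def pure_form_def space_L2_zero)
    show "(\<lambda>m. norm_L2 \<rho> n (\<lambda>i x. (\<Sum>v\<leftarrow>s m. tensor n v i x) - u i x)) \<longlonglongrightarrow> 0"
      unfolding norm_L2_tendsto_0 using fs(2) by (simp add: sum)
  qed
qed

end

section \<open>The explicit finite-rank operator\<close>

definition shape_index :: "nat \<Rightarrow> nat set" where
  "shape_index d = (if d = 0 then {1..4} else {1..3})"

definition shape :: "nat \<Rightarrow> nat \<Rightarrow> real \<Rightarrow> real" where
  "shape d = (if d = 0 then phi0 else phi1)"

lemma finite_shape_index: "finite (shape_index d)"
  by (simp add: shape_index_def)

lemma shape_poly: "\<exists>p. degree p \<le> (if d = 0 then 3 else 2) \<and> shape d i = poly p"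
proof -
  have "\<exists>p. degree p \<le> 3 \<and> phi0 i = poly p"
  proof -
    consider "i = 1" | "i = 2" | "i = 3" | "i \<notin> {1, 2, 3}" by blast
    then show ?thesis
    proof cases
      case 1
      then show ?thesis by (intro exI[of _ "[:0, 1, -2, 1:]"]) (auto simp: phi0_def fun_eq_iff algebra_simps power_def)
    next
      case 2
      then show ?thesis by (intro exI[of _ "[:0, 0, -1, 1:]"]) (auto simp: phi0_def fun_eq_iff algebra_simps power_def)
    next
      case 3
      then show ?thesis by (intro exI[of _ "[:-(1/2), 0, 3, -2:]"]) (auto simp: phi0_def fun_eq_iff algebra_simps power_def)
    next
      case 4
      then show ?thesis by (intro exI[of _ "[:1/2:]"]) (auto simp: phi0_def fun_eq_iff)
    qed
  qed
  moreover have "\<exists>p. degree p \<le> 2 \<and> phi1 i = poly p"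
  proof -
    consider "i = 1" | "i = 2" | "i \<notin> {1, 2}" by blast
    then show ?thesis
    proof cases
      case 1
      then show ?thesis by (intro exI[of _ "[:1, -4, 3:]"]) (auto simp: phi1_def fun_eq_iff algebra_simps power2_eq_square)
    next
      case 2
      then show ?thesis by (intro exI[of _ "[:0, -2, 3:]"]) (auto simp: phi1_def fun_eq_iff algebra_simps power2_eq_square)
    next
      case 3
      then show ?thesis by (intro exI[of _ "[:0, 6, -6:]"]) (auto simp: phi1_def fun_eq_iff algebra_simps power2_eq_square)
    qed
  qed
  ultimately show ?thesis by (simp add: shape_def)
qed

text \<open>Fixing the kernels as a parameter lets the definitions below refer to them;
  \<open>Nbar_kernel\<close> later provides the instance.\<close>

locale interval_kernel = interval +
  fixes g :: "nat \<Rightarrow> nat \<Rightarrow> real \<Rightarrow> real"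
  assumes g_L2: "g d i \<in> space_L2 (leb_I \<rho>)"
    and Nbar0_g: "u \<in> space_L2 (leb_I \<rho>) \<Longrightarrow> Nbar0 \<rho> i u = (\<integral>y. g 0 i y * u y \<partial>leb_I \<rho>)"
    and Nbar1_g: "u \<in> space_L2 (leb_I \<rho>) \<Longrightarrow> d \<noteq> 0 \<Longrightarrow> Nbar1 \<rho> i u = (\<integral>y. g d i y * u y \<partial>leb_I \<rho>)"
begin

lemma proj_g:
  assumes "u \<in> space_L2 (leb_I \<rho>)"
  shows "proj \<rho> d u x = (\<Sum>a\<in>shape_index d. (\<integral>y. g d a y * u y \<partial>leb_I \<rho>) * shape d a x)"
  using assms by (auto simp: proj_def shape_index_def shape_def Nbar0_g Nbar1_g)

lemma shape_L2: "shape d a \<in> space_L2 (leb_I \<rho>)"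
proof -
  obtain p where "shape d a = poly p" using shape_poly by blast
  then show ?thesis by (auto intro!: C0_L2 continuous_intros)
qed

text \<open>The tensor product of the functionals selected by \<open>a\<close>, one per coordinate,
  already extended to all of L2 on the cube.\<close>

definition coef :: "nat \<Rightarrow> (nat \<Rightarrow> nat) \<Rightarrow> (nat \<Rightarrow> nat) \<Rightarrow> ((nat \<Rightarrow> real) \<Rightarrow> real) \<Rightarrow> real" where
  "coef n i a u = (\<integral>y. (\<Prod>j<n. g (i j) (a j) (y j)) * u y \<partial>leb_cube \<rho> n)"

definition indices :: "nat \<Rightarrow> (nat \<Rightarrow> nat) \<Rightarrow> (nat \<Rightarrow> nat) set" where
  "indices n i = (\<Pi>\<^sub>E j\<in>{..<n}. shape_index (i j))"

definition interp :: "nat \<Rightarrow> (nat \<Rightarrow> nat) \<Rightarrow> ((nat \<Rightarrow> real) \<Rightarrow> real) \<Rightarrow> (nat \<Rightarrow> real) \<Rightarrow> real" where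
  "interp n i u x = (\<Sum>a\<in>indices n i. coef n i a u * (\<Prod>j<n. shape (i j) (a j) (x j)))"

lemma finite_indices: "finite (indices n i)"
  unfolding indices_def by (intro finite_PiE finite_shape_index) auto

lemma interp_L2: "interp n i u \<in> space_L2 (leb_cube \<rho> n)"
  unfolding interp_def[abs_def] by (intro space_L2_sum space_L2_scale product_L2 shape_L2)

lemma coef_linear:
  assumes "u \<in> space_L2 (leb_cube \<rho> n)" "v \<in> space_L2 (leb_cube \<rho> n)"
  shows "coef n i a (\<lambda>x. b * u x + c * v x) = b * coef n i a u + c * coef n i a v"
proof -
  let ?G = "\<lambda>y. \<Prod>j<n. g (i j) (a j) (y j)"
  have int: "integrable (leb_cube \<rho> n) (\<lambda>y. ?G y * w y)" if "w \<in> space_L2 (leb_cube \<rho> n)" for w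
    using that by (intro space_L2_mult_integrable product_L2 g_L2)
  have "coef n i a (\<lambda>x. b * u x + c * v x)
      = (\<integral>y. b * (?G y * u y) + c * (?G y * v y) \<partial>leb_cube \<rho> n)"
    unfolding coef_def by (intro Bochner_Integration.integral_cong) (auto simp: algebra_simps)
  also have "\<dots> = b * coef n i a u + c * coef n i a v"
    using int assms by (simp add: coef_def)
  finally show ?thesis .
qed

lemma interp_linear:
  assumes "u \<in> space_L2 (leb_cube \<rho> n)" "v \<in> space_L2 (leb_cube \<rho> n)"
  shows "interp n i (\<lambda>x. b * u x + c * v x) x = b * interp n i u x + c * interp n i v x"
  using assms
  by (simp add: interp_def coef_linear sum.distrib sum_distrib_left algebra_simps)

lemma interp_zero: "interp n i (\<lambda>_. 0) x = 0"
  by (simp add: interp_def coef_def)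

text \<open>The argument enters only through integrals, so a change on a null set leaves the result
  the same at every point.\<close>

lemma interp_cong_AE:
  assumes "u \<in> space_L2 (leb_cube \<rho> n)" "v \<in> space_L2 (leb_cube \<rho> n)" "AE x in leb_cube \<rho> n. u x = v x"
  shows "interp n i u = interp n i v"
proof -
  have "coef n i a u = coef n i a v" for a
    unfolding coef_def
  proof (rule integral_cong_AE)
    have "(\<lambda>y. \<Prod>j<n. g (i j) (a j) (y j)) \<in> space_L2 (leb_cube \<rho> n)"
      by (intro product_L2 g_L2)
    note [measurable] = space_L2_measurable[OF this] space_L2_measurable[OF assms(1)]
      space_L2_measurable[OF assms(2)]
    show "(\<lambda>y. (\<Prod>j<n. g (i j) (a j) (y j)) * u y) \<in> borel_measurable (leb_cube \<rho> n)"
      "(\<lambda>y. (\<Prod>j<n. g (i j) (a j) (y j)) * v y) \<in> borel_measurable (leb_cube \<rho> n)"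
      by (intro borel_measurable_times; fact)+
    show "AE y in leb_cube \<rho> n. (\<Prod>j<n. g (i j) (a j) (y j)) * u y = (\<Prod>j<n. g (i j) (a j) (y j)) * v y"
      using assms(3) by eventually_elim simp
  qed
  then show ?thesis by (simp add: interp_def[abs_def])
qed

lemma interp_bounded:
  "\<exists>C\<ge>0. \<forall>u\<in>space_L2 (leb_cube \<rho> n).
    (\<integral>x. (interp n i u x)\<^sup>2 \<partial>leb_cube \<rho> n) \<le> C * (\<integral>x. (u x)\<^sup>2 \<partial>leb_cube \<rho> n)"
proof -
  let ?M = "leb_cube \<rho> n"
  let ?G = "\<lambda>a y. \<Prod>j<n. g (i j) (a j) (y j)" and ?P = "\<lambda>a x. \<Prod>j<n. shape (i j) (a j) (x j)"
  \<comment> \<open>The squared norm of the rank-one summand with index \<open>a\<close>. The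
    cardinality \<open>?c\<close> pays for bounding the square of a sum by the sum of
    squares.\<close>
  define K where "K a = (\<integral>y. (?G a y)\<^sup>2 \<partial>?M) * (\<integral>x. (?P a x)\<^sup>2 \<partial>?M)" for a
  let ?c = "real (card (indices n i))"
  show ?thesis
  proof (intro exI conjI ballI)
    show "0 \<le> ?c * (\<Sum>a\<in>indices n i. K a)"
      by (intro mult_nonneg_nonneg sum_nonneg) (auto simp: K_def)
    fix u assume u: "u \<in> space_L2 ?M"
    have L2: "(\<lambda>x. coef n i a u * ?P a x) \<in> space_L2 ?M" for a
      by (intro space_L2_scale product_L2 shape_L2)
    have "(\<integral>x. (interp n i u x)\<^sup>2 \<partial>?M) \<le> (\<integral>x. ?c * (\<Sum>a\<in>indices n i. (coef n i a u * ?P a x)\<^sup>2) \<partial>?M)"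
    proof (rule integral_mono)
      show "integrable ?M (\<lambda>x. (interp n i u x)\<^sup>2)"
        by (rule space_L2_integrable[OF interp_L2])
      show "integrable ?M (\<lambda>x. ?c * (\<Sum>a\<in>indices n i. (coef n i a u * ?P a x)\<^sup>2))"
        by (intro integrable_mult_right Bochner_Integration.integrable_sum space_L2_integrable L2)
      show "(interp n i u x)\<^sup>2 \<le> ?c * (\<Sum>a\<in>indices n i. (coef n i a u * ?P a x)\<^sup>2)" for x
        unfolding interp_def
        using sum_squared_le_sum_of_squares[of "\<lambda>a. coef n i a u * ?P a x" "indices n i"]
        by (simp add: mult.commute)
    qed
    also have "\<dots> = ?c * (\<Sum>a\<in>indices n i. \<integral>x. (coef n i a u * ?P a x)\<^sup>2 \<partial>?M)"
      using space_L2_integrable[OF L2] by simp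
    also have "\<dots> \<le> ?c * (\<Sum>a\<in>indices n i. K a * (\<integral>x. (u x)\<^sup>2 \<partial>?M))"
    proof (intro mult_left_mono sum_mono)
      fix a
      have "(coef n i a u)\<^sup>2 \<le> (\<integral>y. (?G a y)\<^sup>2 \<partial>?M) * (\<integral>x. (u x)\<^sup>2 \<partial>?M)"
        unfolding coef_def by (intro L2_Cauchy_Schwarz product_L2 g_L2 u)
      then have "(coef n i a u)\<^sup>2 * (\<integral>x. (?P a x)\<^sup>2 \<partial>?M) \<le> K a * (\<integral>x. (u x)\<^sup>2 \<partial>?M)"
        unfolding K_def using mult_right_mono[of _ _ "\<integral>x. (?P a x)\<^sup>2 \<partial>?M"]
        by (fastforce simp: algebra_simps)
      then show "(\<integral>x. (coef n i a u * ?P a x)\<^sup>2 \<partial>?M) \<le> K a * (\<integral>x. (u x)\<^sup>2 \<partial>?M)"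
        by (simp add: power_mult_distrib)
    qed simp
    finally show "(\<integral>x. (interp n i u x)\<^sup>2 \<partial>?M) \<le> ?c * (\<Sum>a\<in>indices n i. K a) * (\<integral>x. (u x)\<^sup>2 \<partial>?M)"
      by (simp add: sum_distrib_right mult.assoc)
  qed
qed

text \<open>Fubini factors each coefficient into one-dimensional integrals, and a product of sums
  expands into a sum over the choice functions in \<open>indices n i\<close>.\<close>

lemma interp_product:
  assumes f: "\<And>j. j < n \<Longrightarrow> f j \<in> space_L2 (leb_I \<rho>)"
  shows "interp n i (\<lambda>x. \<Prod>j<n. f j (x j)) x = (\<Prod>j<n. proj \<rho> (i j) (f j) (x j))"
proof -
  have coef: "coef n i a (\<lambda>x. \<Prod>j<n. f j (x j)) = (\<Prod>j<n. \<integral>y. g (i j) (a j) y * f j y \<partial>leb_I \<rho>)" for a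
    unfolding coef_def prod.distrib[symmetric]
    using f by (intro product_sigma_finite.product_integral_prod[OF product_sigma_finite_leb_I,
          where f = "\<lambda>j y. g (i j) (a j) y * f j y"] integrable_mult_leb_I g_L2) auto
  have "(\<Prod>j<n. proj \<rho> (i j) (f j) (x j))
      = (\<Prod>j<n. \<Sum>a\<in>shape_index (i j). (\<integral>y. g (i j) a y * f j y \<partial>leb_I \<rho>) * shape (i j) a (x j))"
    using f by (intro prod.cong refl proj_g) auto
  also have "\<dots> = (\<Sum>a\<in>indices n i. \<Prod>j<n. (\<integral>y. g (i j) (a j) y * f j y \<partial>leb_I \<rho>) * shape (i j) (a j) (x j))"
    unfolding indices_def by (rule prod_sum_PiE) (auto simp: finite_shape_index)
  also have "\<dots> = interp n i (\<lambda>x. \<Prod>j<n. f j (x j)) x"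
    by (simp add: interp_def coef prod.distrib)
  finally show ?thesis by simp
qed

lemma interp_sum_list:
  assumes "\<And>v. v \<in> set vs \<Longrightarrow> F v \<in> space_L2 (leb_cube \<rho> n)"
  shows "interp n i (\<lambda>x. \<Sum>v\<leftarrow>vs. F v x) x = (\<Sum>v\<leftarrow>vs. interp n i (F v) x)"
  using assms
proof (induction vs)
  case Nil
  then show ?case by (simp add: interp_zero)
next
  case (Cons v vs)
  have "interp n i (\<lambda>x. 1 * F v x + 1 * (\<Sum>v\<leftarrow>vs. F v x)) x
      = 1 * interp n i (F v) x + 1 * interp n i (\<lambda>x. \<Sum>v\<leftarrow>vs. F v x) x"
    using Cons.prems by (intro interp_linear space_L2_sum_list) auto
  then show ?case using Cons by simp
qed

section \<open>The tensor product operator identified with the explicit one\<close>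

definition interp_form :: "nat \<Rightarrow> (nat \<Rightarrow> nat) \<Rightarrow> formn \<Rightarrow> formn" where
  "interp_form n i u = (\<lambda>l x. if l = i then interp n i (u i) x else 0)"

lemma interp_form_L2: "interp_form n i u \<in> L2_forms \<rho> n"
proof -
  have "interp_form n i u l \<in> space_L2 (leb_cube \<rho> n)" for l
    by (cases "l = i") (simp_all add: interp_form_def interp_L2 space_L2_zero)
  then show ?thesis by (simp add: L2_forms_def)
qed

text \<open>\<open>Proj \<rho> (i j)\<close> reads only the part of degree \<open>i j\<close> and
  returns a pure form of that degree, so only component \<open>i\<close> is read and only component
  \<open>i\<close> is written.\<close>

lemma tensor_Proj:
  assumes i: "i \<in> multi n" and l: "l \<in> multi n" and v: "\<And>j. j < n \<Longrightarrow> v j \<in> L2_form1 \<rho>"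
  shows "tensor n (\<lambda>j. Proj \<rho> (i j) (v j)) l x = (if l = i then interp n i (tensor n v i) x else 0)"
proof -
  have "v j (i j) \<in> space_L2 (leb_I \<rho>)" if "j < n" for j
  proof -
    have "i j \<in> {0, 1}" using i that by (auto simp: multi_def PiE_iff)
    then show ?thesis using v[OF that] by (auto simp: L2_form1_def)
  qed
  then show ?thesis
    using tensor_pure_form[OF i l, of "\<lambda>j. proj \<rho> (i j) (v j (i j))" x]
      interp_product[of n "\<lambda>j. v j (i j)" i x]
    by (simp add: Proj_def tensor_def)
qed

text \<open>By linearity the difference of the images is \<open>interp\<close> of the difference of
  the arguments; the bound of \<open>interp_bounded\<close> sends it to 0 along any approximating
  sequence.\<close>

lemma is_tensor_op_value_interp_form:
  assumes i: "i \<in> multi n" and u: "u \<in> L2_forms \<rho> n"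
  shows "is_tensor_op_value \<rho> n (\<lambda>j. Proj \<rho> (i j)) u (interp_form n i u)"
  unfolding is_tensor_op_value_def
proof (intro conjI allI impI interp_form_L2)
  fix s :: "nat \<Rightarrow> (nat \<Rightarrow> form1) list"
  assume s: "(\<forall>m. \<forall>v\<in>set (s m). \<forall>j<n. v j \<in> L2_form1 \<rho>) \<and>
    (\<lambda>m. norm_L2 \<rho> n (\<lambda>i x. (\<Sum>v\<leftarrow>s m. tensor n v i x) - u i x)) \<longlonglongrightarrow> 0"
  let ?M = "leb_cube \<rho> n"
  let ?S = "\<lambda>m x. \<Sum>v\<leftarrow>s m. tensor n v i x"
  have ui: "u i \<in> space_L2 ?M" using u i by (simp add: L2_forms_def)
  have t: "tensor n v i \<in> space_L2 ?M" if "v \<in> set (s m)" for m v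
    using s that by (intro tensor_L2 i) auto
  have S: "?S m \<in> space_L2 ?M" for m by (intro space_L2_sum_list t)
  have image: "(\<Sum>v\<leftarrow>s m. tensor n (\<lambda>j. Proj \<rho> (i j) (v j)) l x) - interp_form n i u l x
      = (if l = i then interp n i (\<lambda>x. ?S m x - u i x) x else 0)" if l: "l \<in> multi n" for m l x
  proof -
    have "(\<Sum>v\<leftarrow>s m. tensor n (\<lambda>j. Proj \<rho> (i j) (v j)) l x)
        = (\<Sum>v\<leftarrow>s m. if l = i then interp n i (tensor n v i) x else 0)"
      using s by (intro arg_cong[of _ _ sum_list] map_cong refl tensor_Proj i l) auto
    moreover have "interp n i (\<lambda>x. ?S m x - u i x) x = interp n i (?S m) x - interp n i (u i) x"
      using interp_linear[OF S[of m] ui, of i 1 "-1" x] by simp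
    moreover have "interp n i (?S m) x = (\<Sum>v\<leftarrow>s m. interp n i (tensor n v i) x)"
      by (rule interp_sum_list) (rule t)
    ultimately show ?thesis by (simp add: interp_form_def)
  qed
  obtain C where C: "\<And>u. u \<in> space_L2 ?M \<Longrightarrow> (\<integral>x. (interp n i u x)\<^sup>2 \<partial>?M) \<le> C * (\<integral>x. (u x)\<^sup>2 \<partial>?M)"
    using interp_bounded by blast
  have "(\<lambda>m. \<integral>x. (?S m x - u i x)\<^sup>2 \<partial>?M) \<longlonglongrightarrow> 0"
    using s i unfolding norm_L2_tendsto_0 by blast
  then have Clim: "(\<lambda>m. C * (\<integral>x. (?S m x - u i x)\<^sup>2 \<partial>?M)) \<longlonglongrightarrow> 0"
    by (rule tendsto_mult_right_zero)
  have le: "(\<integral>x. (interp n i (\<lambda>x. ?S m x - u i x) x)\<^sup>2 \<partial>?M) \<le> C * (\<integral>x. (?S m x - u i x)\<^sup>2 \<partial>?M)" for m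
    by (rule C[OF space_L2_diff[OF S ui]])
  have lim: "(\<lambda>m. \<integral>x. (interp n i (\<lambda>x. ?S m x - u i x) x)\<^sup>2 \<partial>?M) \<longlonglongrightarrow> 0"
    by (rule LIMSEQ_squeeze_0[OF Clim _ le]) simp
  show "(\<lambda>m. norm_L2 \<rho> n (\<lambda>l x. (\<Sum>v\<leftarrow>s m. tensor n (\<lambda>j. Proj \<rho> (i j) (v j)) l x)
      - interp_form n i u l x)) \<longlonglongrightarrow> 0"
    unfolding norm_L2_tendsto_0
  proof (intro ballI)
    fix l assume "l \<in> multi n"
    note image[OF this]
    then show "(\<lambda>m. \<integral>x. ((\<Sum>v\<leftarrow>s m. tensor n (\<lambda>j. Proj \<rho> (i j) (v j)) l x)
        - interp_form n i u l x)\<^sup>2 \<partial>?M) \<longlonglongrightarrow> 0"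
      using lim by (cases "l = i") simp_all
  qed
qed

lemma Proj_L2: "v \<in> L2_form1 \<rho> \<Longrightarrow> d \<in> {0, 1} \<Longrightarrow> Proj \<rho> d v \<in> L2_form1 \<rho>"
proof -
  assume v: "v \<in> L2_form1 \<rho>" "d \<in> {0, 1}"
  then have "v d \<in> space_L2 (leb_I \<rho>)" by (auto simp: L2_form1_def)
  then have "proj \<rho> d (v d) = (\<lambda>x. \<Sum>a\<in>shape_index d. (\<integral>y. g d a y * v d y \<partial>leb_I \<rho>) * shape d a x)"
    by (intro ext proj_g)
  then have "proj \<rho> d (v d) \<in> space_L2 (leb_I \<rho>)"
    by (auto intro!: space_L2_sum space_L2_scale shape_L2)
  then show ?thesis by (auto simp: L2_form1_def Proj_def pure_form_def space_L2_zero)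
qed

text \<open>Both candidates are limits of the images of one approximating sequence from
  \<open>tensors_dense\<close>, so they agree almost everywhere in each component.\<close>

lemma tensor_op_value_unique:
  assumes n: "1 \<le> n" and i: "i \<in> multi n" and u: "u \<in> L2_forms \<rho> n"
    and w: "is_tensor_op_value \<rho> n (\<lambda>j. Proj \<rho> (i j)) u w"
      "is_tensor_op_value \<rho> n (\<lambda>j. Proj \<rho> (i j)) u w'"
  shows "eq_form \<rho> n w w'"
  unfolding eq_form_def
proof
  fix l assume l: "l \<in> multi n"
  obtain s where s: "\<And>m v j. v \<in> set (s m) \<Longrightarrow> j < n \<Longrightarrow> v j \<in> L2_form1 \<rho>"
    "(\<lambda>m. norm_L2 \<rho> n (\<lambda>i x. (\<Sum>v\<leftarrow>s m. tensor n v i x) - u i x)) \<longlonglongrightarrow> 0"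
    using tensors_dense[OF n u] by blast
  have ij: "i j \<in> {0, 1}" if "j < n" for j using i that by (auto simp: multi_def PiE_iff)
  let ?T = "\<lambda>m x. \<Sum>v\<leftarrow>s m. tensor n (\<lambda>j. Proj \<rho> (i j) (v j)) l x"
  show "AE x in leb_cube \<rho> n. w l x = w' l x"
  proof (rule L2_limit_unique)
    show "?T m \<in> space_L2 (leb_cube \<rho> n)" for m
      using s(1) ij by (intro space_L2_sum_list tensor_L2 l Proj_L2) auto
    show "w l \<in> space_L2 (leb_cube \<rho> n)" "w' l \<in> space_L2 (leb_cube \<rho> n)"
      using w l by (auto simp: is_tensor_op_value_def L2_forms_def)
    have "(\<lambda>m. norm_L2 \<rho> n (\<lambda>l x. (\<Sum>v\<leftarrow>s m. tensor n (\<lambda>j. Proj \<rho> (i j) (v j)) l x) - z l x)) \<longlonglongrightarrow> 0"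
      if "is_tensor_op_value \<rho> n (\<lambda>j. Proj \<rho> (i j)) u z" for z
      using that s unfolding is_tensor_op_value_def by blast
    then have "(\<lambda>m. \<integral>x. (?T m x - z l x)\<^sup>2 \<partial>leb_cube \<rho> n) \<longlonglongrightarrow> 0"
      if "is_tensor_op_value \<rho> n (\<lambda>j. Proj \<rho> (i j)) u z" for z
      using that l unfolding norm_L2_tendsto_0 by blast
    then show "(\<lambda>m. \<integral>x. (?T m x - w l x)\<^sup>2 \<partial>leb_cube \<rho> n) \<longlonglongrightarrow> 0"
      "(\<lambda>m. \<integral>x. (?T m x - w' l x)\<^sup>2 \<partial>leb_cube \<rho> n) \<longlonglongrightarrow> 0"
      using w by blast+
  qed
qed

text \<open>Existence makes the choice by \<open>SOME\<close> a genuine value, and uniqueness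
  identifies it with \<open>interp_form\<close> almost everywhere.\<close>

lemma tensor_op_eq:
  assumes n: "1 \<le> n" and i: "i \<in> multi n" and u: "u \<in> L2_forms \<rho> n"
  shows "tensor_op \<rho> n (\<lambda>j. Proj \<rho> (i j)) u \<in> L2_forms \<rho> n"
    and "eq_form \<rho> n (tensor_op \<rho> n (\<lambda>j. Proj \<rho> (i j)) u) (interp_form n i u)"
proof -
  note val = is_tensor_op_value_interp_form[OF i u]
  have "is_tensor_op_value \<rho> n (\<lambda>j. Proj \<rho> (i j)) u (tensor_op \<rho> n (\<lambda>j. Proj \<rho> (i j)) u)"
    unfolding tensor_op_def by (rule someI[where P = "is_tensor_op_value _ _ _ _", OF val])
  then show "tensor_op \<rho> n (\<lambda>j. Proj \<rho> (i j)) u \<in> L2_forms \<rho> n"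
    "eq_form \<rho> n (tensor_op \<rho> n (\<lambda>j. Proj \<rho> (i j)) u) (interp_form n i u)"
    using tensor_op_value_unique[OF n i u _ val] by (auto simp: is_tensor_op_value_def)
qed

section \<open>The quasi-interpolation operator\<close>

lemma quasi_interp_L2:
  assumes n: "1 \<le> n" and u: "u \<in> L2_forms \<rho> n"
  shows "quasi_interp \<rho> n k u \<in> L2_forms \<rho> n"
proof -
  have "(\<lambda>x. \<Sum>i\<in>chi n k. tensor_op \<rho> n (\<lambda>j. Proj \<rho> (i j)) u l x) \<in> space_L2 (leb_cube \<rho> n)"
    if "l \<in> multi n" for l
    using tensor_op_eq(1)[OF n _ u] chi_subset_multi that
    by (intro space_L2_sum) (auto simp: L2_forms_def)
  then show ?thesis by (simp add: L2_forms_def quasi_interp_def)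
qed

text \<open>The summand of index \<open>i\<close> lives in component \<open>i\<close> alone, so the
  sum over \<open>chi n k\<close> keeps at most the term \<open>i = l\<close>. The finitely many
  exceptional null sets are merged.\<close>

lemma quasi_interp_eq:
  assumes n: "1 \<le> n" and u: "u \<in> L2_forms \<rho> n" and l: "l \<in> multi n"
  shows "AE x in leb_cube \<rho> n. quasi_interp \<rho> n k u l x = (if l \<in> chi n k then interp n l (u l) x else 0)"
proof -
  have fin: "finite (chi n k)" using finite_subset[OF chi_subset_multi finite_multi] .
  have "AE x in leb_cube \<rho> n. \<forall>i\<in>chi n k. tensor_op \<rho> n (\<lambda>j. Proj \<rho> (i j)) u l x = interp_form n i u l x"
    using tensor_op_eq(2)[OF n _ u] chi_subset_multi l
    by (intro AE_finite_allI fin) (auto simp: eq_form_def)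
  then show ?thesis
  proof eventually_elim
    case (elim x)
    then have "quasi_interp \<rho> n k u l x = (\<Sum>i\<in>chi n k. interp_form n i u l x)"
      by (simp add: quasi_interp_def)
    also have "\<dots> = (if l \<in> chi n k then interp n l (u l) x else 0)"
      using fin by (simp add: interp_form_def sum.delta')
    finally show ?case .
  qed
qed

lemma interp_polynomial:
  assumes n: "1 \<le> n"
  shows "\<exists>ps :: (nat \<Rightarrow> real poly) list.
    (\<forall>p\<in>set ps. \<forall>j<n. degree (p j) \<le> (if i j = 0 then 3 else 2)) \<and>
    (\<forall>x. interp n i u x = (\<Sum>p\<leftarrow>ps. \<Prod>j<n. poly (p j) (x j)))"
proof -
  obtain q where q: "\<And>d a. degree (q d a) \<le> (if d = 0 then 3 else 2)"
    "\<And>d a. shape d a = poly (q d a :: real poly)"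
    using shape_poly by metis
  obtain as where as: "set as = indices n i" "distinct as"
    using finite_distinct_list[OF finite_indices] by blast
  \<comment> \<open>\<open>poly_kforms\<close> asks for sums of products without coefficients, so
    the coefficient is absorbed by factor 0, again thanks to \<open>1 \<le> n\<close>; the degree
    does not grow.\<close>
  define p where "p a j = (if j = 0 then smult (coef n i a u) (q (i j) (a j)) else q (i j) (a j))" for a j
  have prod: "(\<Prod>j<n. poly (p a j) (x j)) = coef n i a u * (\<Prod>j<n. shape (i j) (a j) (x j))" for a x
    using n by (simp add: p_def q(2) prod.remove[of "{..<n}" 0])
  show ?thesis
  proof (intro exI[of _ "map p as"] conjI allI ballI impI)
    show "degree (r j) \<le> (if i j = 0 then 3 else 2)" if r: "r \<in> set (map p as)" for r j
    proof -
      obtain a where "r = p a" using r by auto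
      moreover have "degree (p a j) \<le> degree (q (i j) (a j))" by (simp add: p_def)
      ultimately show ?thesis using order_trans[OF _ q(1)] by blast
    qed
    show "interp n i u x = (\<Sum>r\<leftarrow>map p as. \<Prod>j<n. poly (r j) (x j))" for x
      using as by (simp add: interp_def o_def prod sum_list_distinct_conv_sum_set)
  qed
qed

lemma bounded_quasi_interp:
  assumes n: "1 \<le> n"
  shows "bounded_L2_operator \<rho> n (L2_kforms \<rho> n k) (poly_kforms \<rho> n k) (quasi_interp \<rho> n k)"
  unfolding bounded_L2_operator_def
proof (intro conjI ballI allI impI)
  let ?M = "leb_cube \<rho> n" and ?Q = "quasi_interp \<rho> n k"
  have L2: "u \<in> L2_forms \<rho> n" if "u \<in> L2_kforms \<rho> n k" for u
    using that by (simp add: L2_kforms_def)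
  have L2c: "u i \<in> space_L2 ?M" if "u \<in> L2_kforms \<rho> n k" "i \<in> multi n" for u i
    using that by (simp add: L2_kforms_def L2_forms_def)
  note Q_eq = quasi_interp_eq[OF n L2, of _ _ k]
  show "?Q u \<in> poly_kforms \<rho> n k" if u: "u \<in> L2_kforms \<rho> n k" for u
  proof -
    have "AE x in ?M. ?Q u i x = 0" if "i \<in> multi n - chi n k" for i
      using Q_eq[OF u, of i] that by simp
    then have "?Q u \<in> L2_kforms \<rho> n k"
      using quasi_interp_L2[OF n L2[OF u]] by (simp add: L2_kforms_def)
    moreover have "\<exists>ps :: (nat \<Rightarrow> real poly) list.
        (\<forall>p\<in>set ps. \<forall>j<n. degree (p j) \<le> (if i j = 0 then 3 else 2)) \<and>
        (AE x in ?M. ?Q u i x = (\<Sum>p\<leftarrow>ps. \<Prod>j<n. poly (p j) (x j)))" if i: "i \<in> chi n k" for i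
    proof -
      obtain ps :: "(nat \<Rightarrow> real poly) list" where ps:
        "\<forall>p\<in>set ps. \<forall>j<n. degree (p j) \<le> (if i j = 0 then 3 else 2)"
        "\<And>x. interp n i (u i) x = (\<Sum>p\<leftarrow>ps. \<Prod>j<n. poly (p j) (x j))"
        using interp_polynomial[OF n, of i "u i"] by blast
      have "i \<in> multi n" using i chi_subset_multi by blast
      then have "AE x in ?M. ?Q u i x = (\<Sum>p\<leftarrow>ps. \<Prod>j<n. poly (p j) (x j))"
        using Q_eq[OF u, of i] i by (simp add: ps(2))
      with ps(1) show ?thesis by blast
    qed
    ultimately show ?thesis by (simp add: poly_kforms_def)
  qed
  show "eq_form \<rho> n (?Q u) (?Q v)"
    if u: "u \<in> L2_kforms \<rho> n k" and v: "v \<in> L2_kforms \<rho> n k" and eq: "eq_form \<rho> n u v" for u v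
    unfolding eq_form_def
  proof
    fix l assume l: "l \<in> multi n"
    have eq': "interp n l (u l) = interp n l (v l)"
      using eq l by (intro interp_cong_AE[OF L2c[OF u l] L2c[OF v l]]) (simp add: eq_form_def)
    show "AE x in ?M. ?Q u l x = ?Q v l x"
      using Q_eq[OF u l] Q_eq[OF v l] by eventually_elim (simp add: eq')
  qed
  show "eq_form \<rho> n (?Q (\<lambda>i x. a * u i x + b * v i x)) (\<lambda>i x. a * ?Q u i x + b * ?Q v i x)"
    if u: "u \<in> L2_kforms \<rho> n k" and v: "v \<in> L2_kforms \<rho> n k" for u v and a b :: real
    unfolding eq_form_def
  proof
    fix l assume l: "l \<in> multi n"
    have "(\<lambda>i x. a * u i x + b * v i x) \<in> L2_forms \<rho> n"
      unfolding L2_forms_def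
      by (intro CollectI ballI space_L2_add space_L2_scale L2c[OF u] L2c[OF v])
    from quasi_interp_eq[OF n this l, of k] Q_eq[OF u l] Q_eq[OF v l]
    show "AE x in ?M. ?Q (\<lambda>i x. a * u i x + b * v i x) l x = a * ?Q u l x + b * ?Q v l x"
      by eventually_elim (simp add: interp_linear[OF L2c[OF u l] L2c[OF v l]])
  qed
  obtain C where "\<forall>i. 0 \<le> C i \<and> (\<forall>u\<in>space_L2 ?M.
      (\<integral>x. (interp n i u x)\<^sup>2 \<partial>?M) \<le> C i * (\<integral>x. (u x)\<^sup>2 \<partial>?M))"
    using choice[OF allI[OF interp_bounded[of n]]] by (rule exE)
  then have C: "\<And>i. 0 \<le> C i" "\<And>i u. u \<in> space_L2 ?M \<Longrightarrow>
      (\<integral>x. (interp n i u x)\<^sup>2 \<partial>?M) \<le> C i * (\<integral>x. (u x)\<^sup>2 \<partial>?M)"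
    by simp_all
  \<comment> \<open>One constant dominating every \<open>C i\<close>. It bounds squared norms, which
    is why \<open>sqrt K\<close> appears in the final estimate.\<close>
  define K where "K = (\<Sum>i\<in>multi n. C i)"
  have K: "C i \<le> K" "0 \<le> K" if "i \<in> multi n" for i
    unfolding K_def using C(1) that by (auto intro: member_le_sum finite_multi sum_nonneg)
  show "\<exists>C. \<forall>u\<in>L2_kforms \<rho> n k. norm_L2 \<rho> n (?Q u) \<le> C * norm_L2 \<rho> n u"
  proof (intro exI[of _ "sqrt K"] ballI)
    fix u assume u: "u \<in> L2_kforms \<rho> n k"
    have "(\<integral>x. (?Q u l x)\<^sup>2 \<partial>?M) \<le> K * (\<integral>x. (u l x)\<^sup>2 \<partial>?M)" if l: "l \<in> multi n" for l
    proof -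
      have meas: "?Q u l \<in> borel_measurable ?M"
        using quasi_interp_L2[OF n L2[OF u]] l by (auto simp: L2_forms_def dest: space_L2_measurable)
      have "(\<integral>x. (?Q u l x)\<^sup>2 \<partial>?M) = (\<integral>x. (if l \<in> chi n k then interp n l (u l) x else 0)\<^sup>2 \<partial>?M)"
      proof (rule integral_cong_AE)
        show "AE x in ?M. (?Q u l x)\<^sup>2 = (if l \<in> chi n k then interp n l (u l) x else 0)\<^sup>2"
          using Q_eq[OF u l] by eventually_elim simp
      qed (use meas space_L2_measurable[OF interp_L2] in auto)
      also have "\<dots> \<le> (\<integral>x. (interp n l (u l) x)\<^sup>2 \<partial>?M)"
        by (cases "l \<in> chi n k") simp_all
      also have "\<dots> \<le> C l * (\<integral>x. (u l x)\<^sup>2 \<partial>?M)" by (rule C(2)[OF L2c[OF u l]])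
      also have "\<dots> \<le> K * (\<integral>x. (u l x)\<^sup>2 \<partial>?M)" by (intro mult_right_mono K l) simp
      finally show ?thesis .
    qed
    then have "(\<Sum>l\<in>multi n. \<integral>x. (?Q u l x)\<^sup>2 \<partial>?M) \<le> K * (\<Sum>l\<in>multi n. \<integral>x. (u l x)\<^sup>2 \<partial>?M)"
      unfolding sum_distrib_left by (rule sum_mono)
    then show "norm_L2 \<rho> n (?Q u) \<le> sqrt K * norm_L2 \<rho> n u"
      by (simp add: norm_L2_def real_sqrt_mult[symmetric])
  qed
qed

text \<open>On a pure tensor of index \<open>i\<close> all other components of the argument are
  zero, hence so are their images, and component \<open>i\<close> is
  \<open>interp_product\<close>.\<close>

lemma quasi_interp_tensor:
  assumes n: "1 \<le> n" and i: "i \<in> chi n k" and u: "\<And>j. j < n \<Longrightarrow> u j \<in> space_L2 (leb_I \<rho>)"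
  shows "eq_form \<rho> n (quasi_interp \<rho> n k (tensor n (\<lambda>j. pure_form (i j) (u j))))
    (tensor n (\<lambda>j. pure_form (i j) (proj \<rho> (i j) (u j))))"
  unfolding eq_form_def
proof
  let ?t = "tensor n (\<lambda>j. pure_form (i j) (u j))"
  fix l assume l: "l \<in> multi n"
  have im: "i \<in> multi n" using i chi_subset_multi by blast
  have "?t \<in> L2_forms \<rho> n"
    unfolding L2_forms_def using u
    by (auto intro!: tensor_L2 simp: L2_form1_def pure_form_def space_L2_zero)
  from quasi_interp_eq[OF n this l, of k]
  show "AE x in leb_cube \<rho> n. quasi_interp \<rho> n k ?t l x
      = tensor n (\<lambda>j. pure_form (i j) (proj \<rho> (i j) (u j))) l x"
  proof eventually_elim
    case (elim x)
    have "?t l = (\<lambda>x. if l = i then \<Prod>j<n. u j (x j) else 0)"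
      by (intro ext tensor_pure_form im l)
    then show ?case
      using elim i by (auto simp: tensor_pure_form[OF im l] interp_product u interp_zero)
  qed
qed

end

text \<open>The second conjunct ties the operator, which is defined through \<open>SOME\<close>, to
  its intended values on elementary tensors.\<close>

theorem lemma7p6:
  fixes \<rho> :: real and n k :: nat
  assumes "0 < \<rho>" and "\<rho> \<le> 1 / 3" and "n \<ge> 1" and "k \<le> n"
  shows "bounded_L2_operator \<rho> n (L2_kforms \<rho> n k) (poly_kforms \<rho> n k) (quasi_interp \<rho> n k)
    \<and> (\<forall>i\<in>chi n k. \<forall>u. (\<forall>j<n. u j \<in> space_L2 (leb_I \<rho>)) \<longrightarrow>
         eq_form \<rho> n
           (quasi_interp \<rho> n k (tensor n (\<lambda>j. pure_form (i j) (u j))))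
           (tensor n (\<lambda>j. pure_form (i j) (proj \<rho> (i j) (u j)))))"
proof -
  interpret interval \<rho> using assms(1,2) by unfold_locales
  obtain g where "\<And>d i. g d i \<in> space_L2 (leb_I \<rho>)"
    "\<And>i u. u \<in> space_L2 (leb_I \<rho>) \<Longrightarrow> Nbar0 \<rho> i u = (\<integral>y. g (0::nat) i y * u y \<partial>leb_I \<rho>)"
    "\<And>d i u. u \<in> space_L2 (leb_I \<rho>) \<Longrightarrow> d \<noteq> 0 \<Longrightarrow> Nbar1 \<rho> i u = (\<integral>y. g d i y * u y \<partial>leb_I \<rho>)"
    using Nbar_kernel by blast
  then interpret interval_kernel \<rho> g by unfold_locales
  show ?thesis
    using bounded_quasi_interp[OF assms(3)] quasi_interp_tensor[OF assms(3)] by blast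
qed

end
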